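(* Let $S_g$ be a closed, oriented surface of genus $g\ge 2$ with a curve system $\mathcal{L}=\{[\gamma_1],\ldots,[\gamma_{3g-3}]\}$ and pairs of pants $Y_1,\ldots,Y_{2g-2}$. Let $\rho\in\mathcal{Y}(S_g,\mathcal{L})$, write $\Gamma=\rho(\pi_1(S_g))$ and $A_j=\rho([\gamma_j])$. Then $\Gamma$ (that is, the representation $\rho$) is determined up to conjugation in $\mathrm{SL}(3,\mathbb{C})$ by the following data: (1) the traces $\mathrm{tr}(A_1),\ldots,\mathrm{tr}(A_{3g-3})$ and $\mathrm{tr}(A_1^{-1}),\ldots,\mathrm{tr}(A_{3g-3}^{-1})$; (2) the shape invariants $\sigma_+(Y_1),\ldots,\sigma_+(Y_{2g-2})$ and $\sigma_-(Y_1),\ldots,\sigma_-(Y_{2g-2})$; (3) the choice of a root of each of the commutator equations $Q(Y_1),\ldots,Q(Y_{2g-2})$; (4) the twist-bend parameters $(t+i\theta)_\Gamma(\gamma_1),\ldots,(t+i\theta)_\Gamma(\gamma_{3g-3})$ and the bulge-turn parameters $(s+i\phi)_\Gamma(\gamma_1),\ldots,(s+i\phi)_\Gamma(\gamma_{3g-3})$. That is, two representations in $\mathcal{Y}(S_g,\mathcal{L})$ for which all the data (1)-(4) agree are conjugate in $\mathrm{SL}(3,\mathbb{C})$.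
   Context: Surface. A curve system on $S_g$ is a maximal set $\mathcal{L}=\{[\gamma_1],\ldots,[\gamma_{3g-3}]\}$ of distinct non-trivial homotopy classes of simple closed curves having simple, pairwise disjoint representatives $\gamma_j$. The set $S_g\setminus\bigcup_j\gamma_j$ is a disjoint union of $2g-2$ pairs of pants (three-holed spheres) $Y_1,\ldots,Y_{2g-2}$; each $\gamma_j$ is a boundary curve of precisely two pairs of pants, or corresponds to two different boundary curves of the same pair of pants. Write $\pi_1(Y_k)=\langle \alpha_k,\beta_k,\delta_k : \delta_k\beta_k\alpha_k=1\rangle$, the generators corresponding to the three oriented boundary curves. Fix a spanning tree of the graph with vertices $Y_k$ and edges $\gamma_j$. Each $\gamma_j$ corresponds to two boundary generators, with opposite orientations: $a_j\in\pi_1(Y_{k})$, representing $[\gamma_j]$, and $a_j'\in\pi_1(Y_{k'})$ (with $k=k(j)$, $k'=k'(j)$, possibly equal). Then $\pi_1(S_g)$ is generated by the groups $\pi_1(Y_k)$ and elements $d_1,\ldots,d_{3g-3}$, subject to $a_j'=d_ja_j^{-1}d_j^{-1}$ for all $j$ and $d_j=1$ whenever $\gamma_j$ is in the spanning tree (free products with amalgamation along tree edges, HNN extensions along the others). Representations. An element of $\mathrm{SL}(3,\mathbb{C})$ is strongly loxodromic if its eigenvalues have pairwise different absolute values. $\mathcal{Y}(S_g,\mathcal{L})$ is the space of conjugacy classes of representations $\rho:\pi_1(S_g)\to\mathrm{SL}(3,\mathbb{C})$ such that each $A_j=\rho([\gamma_j])=\rho(a_j)$ is strongly loxodromic and the restriction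 of $\rho$ to each $\pi_1(Y_k)$ is irreducible (no proper non-zero invariant subspace of $\mathbb{C}^3$). Pants data. For $A=\rho(\alpha_k)$, $B=\rho(\beta_k)$, $C=\rho(\delta_k)$ (so $CBA=I$) the shape invariants are $$\sigma_+(Y_k)=\mathrm{tr}(A^{-1}B)-\mathrm{tr}(A^{-1})\mathrm{tr}(B),\qquad \sigma_-(Y_k)=\mathrm{tr}(B^{-1}A)-\mathrm{tr}(B^{-1})\mathrm{tr}(A).$$ They are invariant under cyclic permutation of $A,B,C$. The commutator equation $Q(Y_k)$ is $X^2-SX+P=0$ with $S=\mathrm{tr}[A,B]+\mathrm{tr}[B,A]$ and $P=\mathrm{tr}[A,B]\,\mathrm{tr}[B,A]$, where $[A,B]=ABA^{-1}B^{-1}$; by a theorem of Lawton, $S$ and $P$ are universal polynomials in $\mathrm{tr}(A^{\pm1}),\mathrm{tr}(B^{\pm1}),\mathrm{tr}(C^{\pm1}),\sigma_\pm(Y_k)$, and the choice of a root means the specification of which root is $\mathrm{tr}[A,B]$. An irreducible representation of $\pi_1(Y_k)$ is determined up to conjugation by these eight quantities and this choice of root. Twist-bend and bulge-turn. For each value of the data (1)-(3) that is attained, fix once and for all a reference representation $\rho^0$ in $\mathcal{Y}(S_g,\mathcal{L})$ with this data. If $\rho$ has the same data (1)-(3), there are $g_k\in\mathrm{SL}(3,\mathbb{C})$ with $\rho|_{\pi_1(Y_k)}=g_k\,\rho^0|_{\pi_1(Y_k)}\,g_k^{-1}$, unique up to multiplication by cube roots of unity. For each $j$ there is $K_j$ in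 the centraliser of $\rho^0(a_j)$ describing the gluing of $\rho$ along $\gamma_j$ relative to $\rho^0$: for $\gamma_j$ in the spanning tree, $g_k^{-1}g_{k'}=K_j$; otherwise $g_{k'}^{-1}\rho(d_j)g_k=\rho^0(d_j)K_j$. Let $\mathbf{v}_+,\mathbf{v}_0,\mathbf{v}_-$ be eigenvectors of $\rho^0(a_j)$ for its eigenvalues of largest, middle and smallest absolute value, and let $\kappa_1,\kappa_2,\kappa_3$ be the corresponding eigenvalues of $K_j$. The bulge-turn $v=(s+i\phi)_\Gamma(\gamma_j)$ is defined by $\kappa_2=e^{2v}$, with $\phi\in\mathbb{R}/\pi\mathbb{Z}$ (representative in $[0,\pi)$), and then the twist-bend $u=(t+i\theta)_\Gamma(\gamma_j)$ is defined by $\kappa_1=e^{u-v}$, with $\theta\in\mathbb{R}/2\pi\mathbb{Z}$. Thus, in the basis $\mathbf{v}_+,\mathbf{v}_0,\mathbf{v}_-$, $K_j=T^uU^v$ with $T^u=\mathrm{diag}(e^u,1,e^{-u})$ and $U^v=\mathrm{diag}(e^{-v},e^{2v},e^{-v})$. Here $t,\theta,s,\phi$ are real: twist, bend, bulge, turn. Parameters of two representations agree if they agree for some admissible choices of the $g_k$. *)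

theory Defs
  imports
    "HOL-Analysis.Analysis"
    "HOL-Algebra.Generated_Groups"
    "HOL-Computational_Algebra.Polynomial"
begin

section \<open>Closed oriented surfaces and curve systems\<close>

text \<open>
  The closed oriented surface of genus \<open>g\<close> is the quotient of a \<open>4g\<close>-gon with boundary word
  \<open>\<Prod> a b a\<^sup>-\<^sup>1 b\<^sup>-\<^sup>1\<close>. The polygon is the closed unit disc, whose boundary circle is divided
  into \<open>4g\<close> arcs; arc \<open>m\<close> (with \<open>m mod 4 \<in> {0, 1}\<close>) is glued to arc \<open>m + 2\<close>, reversed.
\<close>

definition polygon_glue :: "nat \<Rightarrow> complex \<Rightarrow> complex \<Rightarrow> bool" where
  "polygon_glue g z w \<longleftrightarrow>
     (\<exists>m t. m < 4 * g \<and> m mod 4 \<in> {0, 1} \<and> t \<in> {0..1} \<and>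
        z = cis (2 * pi * (real m + t) / real (4 * g)) \<and>
        w = cis (2 * pi * (real m + 3 - t) / real (4 * g)))"

definition closed_surface :: "nat \<Rightarrow> 'a::topological_space set \<Rightarrow> bool" where
  "closed_surface g S \<longleftrightarrow>
     (\<exists>q. quotient_map (top_of_set (cball 0 1)) (top_of_set S) q \<and>
        (\<forall>z\<in>cball 0 1. \<forall>w\<in>cball 0 1. q z = q w \<longleftrightarrow> equivclp (polygon_glue g) z w))"

text \<open>
  Homotopy classes of curves are free and unoriented: the two orientations of a curve must not
  count as distinct elements of a curve system, as they have disjoint (parallel) representatives.
\<close>

definition free_class :: "'a::topological_space set \<Rightarrow> (real \<Rightarrow> 'a) \<Rightarrow> (real \<Rightarrow> 'a) set" where
  "free_class S p = {q. homotopic_loops S p q \<or> homotopic_loops S (reversepath p) q}"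

definition simple_closed_curve :: "'a::topological_space set \<Rightarrow> (real \<Rightarrow> 'a) \<Rightarrow> bool" where
  "simple_closed_curve S p \<longleftrightarrow>
     simple_path p \<and> pathfinish p = pathstart p \<and> path_image p \<subseteq> S"

definition nontrivial_curve :: "'a::topological_space set \<Rightarrow> (real \<Rightarrow> 'a) \<Rightarrow> bool" where
  "nontrivial_curve S p \<longleftrightarrow> \<not> (\<exists>a. homotopic_loops S p (\<lambda>_. a))"

definition disjointly_realizable :: "'a::topological_space set \<Rightarrow> (real \<Rightarrow> 'a) set set \<Rightarrow> bool" where
  "disjointly_realizable S L \<longleftrightarrow>
     (\<exists>r. (\<forall>c\<in>L. simple_closed_curve S (r c) \<and> nontrivial_curve S (r c) \<and> c = free_class S (r c)) \<and>
          (\<forall>c\<in>L. \<forall>c'\<in>L. c \<noteq> c' \<longrightarrow> path_image (r c) \<inter> path_image (r c') = {}))"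

definition curve_system :: "'a::topological_space set \<Rightarrow> (real \<Rightarrow> 'a) set set \<Rightarrow> bool" where
  "curve_system S L \<longleftrightarrow> disjointly_realizable S L \<and>
     (\<forall>L'. disjointly_realizable S L' \<and> L \<subseteq> L' \<longrightarrow> L' = L)"

section \<open>The fundamental group\<close>

definition loop_at :: "'a::topological_space set \<Rightarrow> 'a \<Rightarrow> (real \<Rightarrow> 'a) \<Rightarrow> bool" where
  "loop_at S x p \<longleftrightarrow> path p \<and> path_image p \<subseteq> S \<and> pathstart p = x \<and> pathfinish p = x"

definition path_class :: "'a::topological_space set \<Rightarrow> (real \<Rightarrow> 'a) \<Rightarrow> (real \<Rightarrow> 'a) set" where
  "path_class S p = {q. homotopic_paths S p q}"

definition fundamental_group :: "'a::topological_space set \<Rightarrow> 'a \<Rightarrow> (real \<Rightarrow> 'a) set monoid" where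
  "fundamental_group S x =
     \<lparr>carrier = path_class S ` {p. loop_at S x p},
      monoid.mult = (\<lambda>P Q. {r. \<exists>p\<in>P. \<exists>q\<in>Q. homotopic_paths S (p +++ q) r}),
      one = path_class S (\<lambda>_. x)\<rparr>"

lemma path_class_eq_iff:
  assumes "path p" "path_image p \<subseteq> S"
  shows "path_class S p = path_class S q \<longleftrightarrow> homotopic_paths S p q"
  using assms unfolding path_class_def
  by (auto intro: homotopic_paths_trans homotopic_paths_sym)

lemma fundamental_group_mult:
  assumes "loop_at S x p" "loop_at S x q"
  shows "path_class S p \<otimes>\<^bsub>fundamental_group S x\<^esub> path_class S q = path_class S (p +++ q)"
proof -
  have *: "homotopic_paths S (p +++ q) r"
    if "homotopic_paths S p p'" "homotopic_paths S q q'" "homotopic_paths S (p' +++ q') r" for p' q' r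
  proof -
    have "pathfinish p = pathstart q"
      using assms by (simp add: loop_at_def)
    then show ?thesis
      using that homotopic_paths_join homotopic_paths_trans by blast
  qed
  have "{r. \<exists>p'\<in>path_class S p. \<exists>q'\<in>path_class S q. homotopic_paths S (p' +++ q') r} =
      path_class S (p +++ q)"
  proof (intro equalityI subsetI)
    fix r assume "r \<in> path_class S (p +++ q)"
    moreover have "p \<in> path_class S p" "q \<in> path_class S q"
      using assms by (simp_all add: path_class_def loop_at_def)
    ultimately show "r \<in> {r. \<exists>p'\<in>path_class S p. \<exists>q'\<in>path_class S q. homotopic_paths S (p' +++ q') r}"
      unfolding path_class_def by blast
  next
    fix r assume "r \<in> {r. \<exists>p'\<in>path_class S p. \<exists>q'\<in>path_class S q. homotopic_paths S (p' +++ q') r}"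
    then show "r \<in> path_class S (p +++ q)"
      using * unfolding path_class_def by blast
  qed
  then show ?thesis
    by (simp add: fundamental_group_def)
qed

lemma const_path_laws:
  assumes "path p" "path_image p \<subseteq> S"
  shows "homotopic_paths S ((\<lambda>_. pathstart p) +++ p) p"
    and "homotopic_paths S (reversepath p +++ p) (\<lambda>_. pathfinish p)"
proof -
  have id: "path (\<lambda>t::real. t)" "path_image (\<lambda>t::real. t) \<subseteq> {0..1}"
    by (auto simp: path_def path_image_def)
  have p: "continuous_on {0..1} p" "p \<in> {0..1} \<rightarrow> S"
    using assms by (auto simp: path_def path_image_def)
  have "p \<circ> (linepath 0 0 +++ (\<lambda>t. t)) = (\<lambda>_. pathstart p) +++ p"
       "p \<circ> (reversepath (\<lambda>t. t) +++ (\<lambda>t. t)) = reversepath p +++ p"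
       "p \<circ> linepath 1 1 = (\<lambda>_. pathfinish p)" "p \<circ> (\<lambda>t. t) = p"
    by (auto simp: fun_eq_iff joinpaths_def linepath_def pathstart_def pathfinish_def reversepath_def)
  with homotopic_paths_continuous_image[OF homotopic_paths_lid[OF id] p]
       homotopic_paths_continuous_image[OF homotopic_paths_linv[OF id] p]
  show "homotopic_paths S ((\<lambda>_. pathstart p) +++ p) p"
    and "homotopic_paths S (reversepath p +++ p) (\<lambda>_. pathfinish p)"
    by (simp_all add: pathstart_def pathfinish_def)
qed

lemma loop_at_join: "loop_at S x p \<Longrightarrow> loop_at S x q \<Longrightarrow> loop_at S x (p +++ q)"
  by (auto simp: loop_at_def subset_path_image_join)

lemma group_fundamental_group:
  assumes "x \<in> S"
  shows "group (fundamental_group S x)"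
proof (rule groupI)
  let ?G = "fundamental_group S x"
  have carr: "carrier ?G = path_class S ` {p. loop_at S x p}"
    and one: "\<one>\<^bsub>?G\<^esub> = path_class S (\<lambda>_. x)"
    by (simp_all add: fundamental_group_def)
  have const: "loop_at S x (\<lambda>_. x)"
    using assms by (auto simp: loop_at_def path_def path_image_def pathstart_def pathfinish_def)
  show "\<one>\<^bsub>?G\<^esub> \<in> carrier ?G"
    using const by (auto simp: carr one)
  fix P assume "P \<in> carrier ?G"
  then obtain p where p: "loop_at S x p" "P = path_class S p"
    by (auto simp: carr)
  have hp: "path p" "path_image p \<subseteq> S" "pathstart p = x" "pathfinish p = x"
    using p(1) by (auto simp: loop_at_def)
  have join: "path (q +++ r)" "path_image (q +++ r) \<subseteq> S" if "loop_at S x q" "loop_at S x r" for q r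
    using loop_at_join[OF that] by (auto simp: loop_at_def)
  show "\<one>\<^bsub>?G\<^esub> \<otimes>\<^bsub>?G\<^esub> P = P"
    using const_path_laws(1)[OF hp(1,2)] join[OF const p(1)]
    by (simp add: one p fundamental_group_mult const path_class_eq_iff hp)
  have rev: "loop_at S x (reversepath p)"
    using hp by (auto simp: loop_at_def)
  show "\<exists>Q\<in>carrier ?G. Q \<otimes>\<^bsub>?G\<^esub> P = \<one>\<^bsub>?G\<^esub>"
    using const_path_laws(2)[OF hp(1,2)] join[OF rev p(1)] rev
    by (intro bexI[of _ "path_class S (reversepath p)"])
       (auto simp: one p carr fundamental_group_mult path_class_eq_iff hp)
  fix Q assume "Q \<in> carrier ?G"
  then obtain q where q: "loop_at S x q" "Q = path_class S q"
    by (auto simp: carr)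
  show "P \<otimes>\<^bsub>?G\<^esub> Q \<in> carrier ?G"
    using loop_at_join[OF p(1) q(1)] by (auto simp: p(2) q(2) fundamental_group_mult p(1) q(1) carr)
  fix R assume "R \<in> carrier ?G"
  then obtain r where r: "loop_at S x r" "R = path_class S r"
    by (auto simp: carr)
  have "homotopic_paths S (p +++ (q +++ r)) ((p +++ q) +++ r)"
    using p(1) q(1) r(1) by (intro homotopic_paths_assoc) (auto simp: loop_at_def)
  then have "path_class S (p +++ (q +++ r)) = path_class S ((p +++ q) +++ r)"
    using join[OF p(1) loop_at_join[OF q(1) r(1)]] by (simp add: path_class_eq_iff)
  then show "P \<otimes>\<^bsub>?G\<^esub> Q \<otimes>\<^bsub>?G\<^esub> R = P \<otimes>\<^bsub>?G\<^esub> (Q \<otimes>\<^bsub>?G\<^esub> R)"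
    by (simp add: p(2) q(2) r(2) fundamental_group_mult p(1) q(1) r(1) loop_at_join)
qed

section \<open>Group presentations\<close>

text \<open>
  The letter \<open>(x, True)\<close> stands for the generator \<open>x\<close>, the letter \<open>(x, False)\<close> for its inverse.
\<close>

primrec eval_word :: "('b, 'm) monoid_scheme \<Rightarrow> ('x \<Rightarrow> 'b) \<Rightarrow> ('x \<times> bool) list \<Rightarrow> 'b" where
  "eval_word G f [] = \<one>\<^bsub>G\<^esub>"
| "eval_word G f (l # w) =
     (if snd l then f (fst l) else inv\<^bsub>G\<^esub> f (fst l)) \<otimes>\<^bsub>G\<^esub> eval_word G f w"

inductive word_step :: "('x \<times> bool) list set \<Rightarrow> ('x \<times> bool) list \<Rightarrow> ('x \<times> bool) list \<Rightarrow> bool"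
  for R where
  cancel: "word_step R (u @ [(x, b), (x, \<not> b)] @ v) (u @ v)"
| relator: "r \<in> R \<Longrightarrow> word_step R (u @ r @ v) (u @ v)"

definition presented_by ::
    "('b, 'm) monoid_scheme \<Rightarrow> 'x set \<Rightarrow> ('x \<times> bool) list set \<Rightarrow> ('x \<Rightarrow> 'b) \<Rightarrow> bool" where
  "presented_by G X R f \<longleftrightarrow>
     f ` X \<subseteq> carrier G \<and> generate G (f ` X) = carrier G \<and>
     (\<forall>w \<in> lists (X \<times> UNIV). eval_word G f w = \<one>\<^bsub>G\<^esub> \<longleftrightarrow> equivclp (word_step R) w [])"

section \<open>Surfaces with a curve system and a choice of generators\<close>

text \<open>
  The three boundary generators of \<open>\<pi>\<^sub>1(Y\<^sub>k)\<close> are \<open>\<alpha>\<^sub>k, \<beta>\<^sub>k, \<delta>\<^sub>k\<close>. In a generating set of the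
  fundamental group of the surface, \<open>Bd (k, b)\<close> is the boundary generator \<open>b\<close> of \<open>\<pi>\<^sub>1(Y\<^sub>k)\<close> and
  \<open>St j\<close> is the stable letter \<open>d\<^sub>j\<close>.
\<close>

datatype bdry = Alpha | Beta | Delta

datatype gen = Bd "nat \<times> bdry" | St nat

text \<open>
  \<open>side M j\<close> and \<open>side' M j\<close> are the pairs (index of a pair of pants, boundary curve) of the two
  sides of \<open>curve M j\<close>; thus \<open>elt M (Bd (side M j))\<close> is \<open>a\<^sub>j\<close>, \<open>elt M (Bd (side' M j))\<close> is \<open>a\<^sub>j'\<close>,
  and \<open>k(j)\<close>, \<open>k'(j)\<close> are the first components. \<open>tree M\<close> is the set of indices \<open>j\<close> of the curves in the
  spanning tree.
\<close>

record 'a marked_surface =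
  genus :: nat
  surf :: "'a set"
  base :: 'a
  curve :: "nat \<Rightarrow> real \<Rightarrow> 'a"
  pants :: "nat \<Rightarrow> 'a set"
  side :: "nat \<Rightarrow> nat \<times> bdry"
  side' :: "nat \<Rightarrow> nat \<times> bdry"
  tree :: "nat set"
  elt :: "gen \<Rightarrow> (real \<Rightarrow> 'a) set"

definition ncurves :: "('a, 'z) marked_surface_scheme \<Rightarrow> nat" where
  "ncurves M = 3 * genus M - 3"

definition npants :: "('a, 'z) marked_surface_scheme \<Rightarrow> nat" where
  "npants M = 2 * genus M - 2"

abbreviation surface_group ::
    "('a::topological_space, 'z) marked_surface_scheme \<Rightarrow> (real \<Rightarrow> 'a) set monoid" where
  "surface_group M \<equiv> fundamental_group (surf M) (base M)"

definition pants_group ::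
    "('a::topological_space, 'z) marked_surface_scheme \<Rightarrow> nat \<Rightarrow> (real \<Rightarrow> 'a) set set" where
  "pants_group M k = generate (surface_group M) (range (\<lambda>b. elt M (Bd (k, b))))"

definition pants_decomposition :: "('a::topological_space, 'z) marked_surface_scheme \<Rightarrow> bool" where
  "pants_decomposition M \<longleftrightarrow>
     closed_surface (genus M) (surf M) \<and>
     (\<forall>j<ncurves M. simple_closed_curve (surf M) (curve M j)) \<and>
     (\<forall>i<ncurves M. \<forall>j<ncurves M. i \<noteq> j \<longrightarrow> path_image (curve M i) \<inter> path_image (curve M j) = {}) \<and>
     inj_on (\<lambda>j. free_class (surf M) (curve M j)) {..<ncurves M} \<and>
     curve_system (surf M) ((\<lambda>j. free_class (surf M) (curve M j)) ` {..<ncurves M}) \<and>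
     bij_betw (pants M) {..<npants M}
       (components (surf M - (\<Union>j<ncurves M. path_image (curve M j)))) \<and>
     (\<forall>k<npants M. pants M k homeomorphic (UNIV - {0, 1} :: complex set)) \<and>
     (\<forall>j<ncurves M. \<forall>k<npants M.
        path_image (curve M j) \<subseteq> closure (pants M k) \<longleftrightarrow> k = fst (side M j) \<or> k = fst (side' M j)) \<and>
     bij_betw (\<lambda>(j, s). if s then side M j else side' M j)
       ({..<ncurves M} \<times> UNIV) ({..<npants M} \<times> UNIV)"

definition joined :: "('a, 'z) marked_surface_scheme \<Rightarrow> nat set \<Rightarrow> nat \<Rightarrow> nat \<Rightarrow> bool" where
  "joined M E = equivclp (\<lambda>k k'. \<exists>j\<in>E. k = fst (side M j) \<and> k' = fst (side' M j))"

definition spanning_tree :: "('a, 'z) marked_surface_scheme \<Rightarrow> bool" where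
  "spanning_tree M \<longleftrightarrow> tree M \<subseteq> {..<ncurves M} \<and>
     (\<forall>k<npants M. \<forall>k'<npants M. joined M (tree M) k k') \<and>
     (\<forall>j\<in>tree M. \<not> joined M (tree M - {j}) (fst (side M j)) (fst (side' M j)))"

text \<open>
  \<open>pants_group M k\<close> is the image of the fundamental group of \<open>Y\<^sub>k\<close> (transported to the base point
  along some path \<open>c\<close>), and its three generators are peripheral loops: \<open>a\<^sub>j\<close> runs along \<open>\<gamma>\<^sub>j\<close> and
  \<open>a\<^sub>j'\<close> runs along \<open>\<gamma>\<^sub>j\<close> in the opposite direction.
\<close>

definition peripheral_generators ::
    "('a::topological_space, 'z) marked_surface_scheme \<Rightarrow> nat \<Rightarrow> bool" where
  "peripheral_generators M k \<longleftrightarrow>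
     (\<exists>c y. path c \<and> path_image c \<subseteq> surf M \<and> pathstart c = base M \<and> pathfinish c = y \<and>
        y \<in> pants M k \<and>
        pants_group M k =
          (\<lambda>p. path_class (surf M) (c +++ p +++ reversepath c)) ` {p. loop_at (pants M k) y p} \<and>
        (\<forall>j<ncurves M. \<forall>b. side M j = (k, b) \<longrightarrow>
           (\<exists>p. loop_at (pants M k) y p \<and>
              elt M (Bd (k, b)) = path_class (surf M) (c +++ p +++ reversepath c) \<and>
              homotopic_loops (pants M k \<union> path_image (curve M j)) p (curve M j))) \<and>
        (\<forall>j<ncurves M. \<forall>b. side' M j = (k, b) \<longrightarrow>
           (\<exists>p. loop_at (pants M k) y p \<and>
              elt M (Bd (k, b)) = path_class (surf M) (c +++ p +++ reversepath c) \<and>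
              homotopic_loops (pants M k \<union> path_image (curve M j)) p (reversepath (curve M j)))))"

definition surface_gens :: "('a, 'z) marked_surface_scheme \<Rightarrow> gen set" where
  "surface_gens M = Bd ` ({..<npants M} \<times> UNIV) \<union> St ` {..<ncurves M}"

text \<open>
  The relations are \<open>\<delta>\<^sub>k \<beta>\<^sub>k \<alpha>\<^sub>k = 1\<close>, \<open>a\<^sub>j' = d\<^sub>j a\<^sub>j\<^sup>-\<^sup>1 d\<^sub>j\<^sup>-\<^sup>1\<close> (written \<open>a\<^sub>j' d\<^sub>j a\<^sub>j d\<^sub>j\<^sup>-\<^sup>1 = 1\<close>), and \<open>d\<^sub>j = 1\<close>
  for \<open>j\<close> in the spanning tree.
\<close>

definition surface_rels :: "('a, 'z) marked_surface_scheme \<Rightarrow> (gen \<times> bool) list set" where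
  "surface_rels M =
     {[(Bd (k, Delta), True), (Bd (k, Beta), True), (Bd (k, Alpha), True)] | k. k < npants M} \<union>
     {[(Bd (side' M j), True), (St j, True), (Bd (side M j), True), (St j, False)] | j. j < ncurves M} \<union>
     {[(St j, True)] | j. j \<in> tree M}"

definition surface_marking :: "('a::topological_space, 'z) marked_surface_scheme \<Rightarrow> bool" where
  "surface_marking M \<longleftrightarrow>
     pants_decomposition M \<and> spanning_tree M \<and> base M \<in> surf M \<and>
     (\<forall>k<npants M. peripheral_generators M k) \<and>
     presented_by (surface_group M) (surface_gens M) (surface_rels M) (elt M)"

section \<open>Representations into SL(3,C)\<close>

type_synonym mat3 = "complex^3^3"

definition SL3 :: "mat3 monoid" where
  "SL3 = \<lparr>carrier = {A. det A = 1}, monoid.mult = (**), one = mat 1\<rparr>"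

definition has_eigenpair :: "mat3 \<Rightarrow> complex \<Rightarrow> complex^3 \<Rightarrow> bool" where
  "has_eigenpair A l x \<longleftrightarrow> x \<noteq> 0 \<and> A *v x = l *s x"

definition strongly_loxodromic :: "mat3 \<Rightarrow> bool" where
  "strongly_loxodromic A \<longleftrightarrow> A \<in> carrier SL3 \<and>
     (\<exists>l1 l2 l3 x1 x2 x3. has_eigenpair A l1 x1 \<and> has_eigenpair A l2 x2 \<and> has_eigenpair A l3 x3 \<and>
        cmod l1 > cmod l2 \<and> cmod l2 > cmod l3)"

definition irreducible_on :: "'b set \<Rightarrow> ('b \<Rightarrow> mat3) \<Rightarrow> bool" where
  "irreducible_on H \<rho> \<longleftrightarrow>
     (\<forall>V. vec.subspace V \<and> (\<forall>x\<in>H. \<forall>v\<in>V. \<rho> x *v v \<in> V) \<longrightarrow> V = {0} \<or> V = UNIV)"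

text \<open>Representatives of the points of the space of conjugacy classes \<open>\<Y>(S\<^sub>g, \<L>)\<close>.\<close>

definition rep_space ::
    "('a::topological_space, 'z) marked_surface_scheme \<Rightarrow> ((real \<Rightarrow> 'a) set \<Rightarrow> mat3) set" where
  "rep_space M =
     {\<rho> \<in> hom (surface_group M) SL3.
        (\<forall>j<ncurves M. strongly_loxodromic (\<rho> (elt M (Bd (side M j))))) \<and>
        (\<forall>k<npants M. irreducible_on (pants_group M k) \<rho>)}"

definition conjugate_reps ::
    "('a::topological_space, 'z) marked_surface_scheme \<Rightarrow>
     ((real \<Rightarrow> 'a) set \<Rightarrow> mat3) \<Rightarrow> ((real \<Rightarrow> 'a) set \<Rightarrow> mat3) \<Rightarrow> bool" where
  "conjugate_reps M \<rho> \<rho>' \<longleftrightarrow>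
     (\<exists>h \<in> carrier SL3. \<forall>x \<in> carrier (surface_group M). \<rho>' x = h ** \<rho> x ** matrix_inv h)"

section \<open>Traces, shape invariants and commutator equations\<close>

definition sigma_plus :: "mat3 \<Rightarrow> mat3 \<Rightarrow> complex" where
  "sigma_plus A B = trace (matrix_inv A ** B) - trace (matrix_inv A) * trace B"

definition sigma_minus :: "mat3 \<Rightarrow> mat3 \<Rightarrow> complex" where
  "sigma_minus A B = trace (matrix_inv B ** A) - trace (matrix_inv B) * trace A"

definition commutator_trace :: "mat3 \<Rightarrow> mat3 \<Rightarrow> complex" where
  "commutator_trace A B = trace (A ** B ** matrix_inv A ** matrix_inv B)"

definition commutator_equation :: "mat3 \<Rightarrow> mat3 \<Rightarrow> complex poly" where
  "commutator_equation A B =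
     (let S = commutator_trace A B + commutator_trace B A;
          P = commutator_trace A B * commutator_trace B A
      in [:P, - S, 1:])"

lemma commutator_trace_root: "poly (commutator_equation A B) (commutator_trace A B) = 0"
  by (simp add: commutator_equation_def Let_def algebra_simps)

definition same_traces ::
    "('a, 'z) marked_surface_scheme \<Rightarrow>
     ((real \<Rightarrow> 'a) set \<Rightarrow> mat3) \<Rightarrow> ((real \<Rightarrow> 'a) set \<Rightarrow> mat3) \<Rightarrow> bool" where
  "same_traces M \<rho> \<rho>' \<longleftrightarrow>
     (\<forall>j<ncurves M. let a = elt M (Bd (side M j)) in
        trace (\<rho> a) = trace (\<rho>' a) \<and> trace (matrix_inv (\<rho> a)) = trace (matrix_inv (\<rho>' a)))"

definition same_shapes ::
    "('a, 'z) marked_surface_scheme \<Rightarrow>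
     ((real \<Rightarrow> 'a) set \<Rightarrow> mat3) \<Rightarrow> ((real \<Rightarrow> 'a) set \<Rightarrow> mat3) \<Rightarrow> bool" where
  "same_shapes M \<rho> \<rho>' \<longleftrightarrow>
     (\<forall>k<npants M. let \<alpha> = elt M (Bd (k, Alpha)); \<beta> = elt M (Bd (k, Beta)) in
        sigma_plus (\<rho> \<alpha>) (\<rho> \<beta>) = sigma_plus (\<rho>' \<alpha>) (\<rho>' \<beta>) \<and>
        sigma_minus (\<rho> \<alpha>) (\<rho> \<beta>) = sigma_minus (\<rho>' \<alpha>) (\<rho>' \<beta>))"

text \<open>
  The choice of a root of the commutator equation is the specification of which root is
  \<open>tr[A, B]\<close>.
\<close>

definition same_roots ::
    "('a, 'z) marked_surface_scheme \<Rightarrow>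
     ((real \<Rightarrow> 'a) set \<Rightarrow> mat3) \<Rightarrow> ((real \<Rightarrow> 'a) set \<Rightarrow> mat3) \<Rightarrow> bool" where
  "same_roots M \<rho> \<rho>' \<longleftrightarrow>
     (\<forall>k<npants M. let \<alpha> = elt M (Bd (k, Alpha)); \<beta> = elt M (Bd (k, Beta)) in
        commutator_trace (\<rho> \<alpha>) (\<rho> \<beta>) = commutator_trace (\<rho>' \<alpha>) (\<rho>' \<beta>))"

section \<open>Twist-bend and bulge-turn parameters\<close>

text \<open>
  \<open>ref \<rho>\<close> is the reference representation fixed for the values of the traces, the shape
  invariants and the chosen roots of \<open>\<rho>\<close>; it depends on nothing else.
\<close>

definition reference_choice ::
    "('a::topological_space, 'z) marked_surface_scheme \<Rightarrow>
     (((real \<Rightarrow> 'a) set \<Rightarrow> mat3) \<Rightarrow> ((real \<Rightarrow> 'a) set \<Rightarrow> mat3)) \<Rightarrow> bool" where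
  "reference_choice M ref \<longleftrightarrow>
     (\<forall>\<rho> \<in> rep_space M. ref \<rho> \<in> rep_space M \<and>
        same_traces M (ref \<rho>) \<rho> \<and> same_shapes M (ref \<rho>) \<rho> \<and> same_roots M (ref \<rho>) \<rho>) \<and>
     (\<forall>\<rho> \<in> rep_space M. \<forall>\<rho>' \<in> rep_space M.
        same_traces M \<rho> \<rho>' \<and> same_shapes M \<rho> \<rho>' \<and> same_roots M \<rho> \<rho>' \<longrightarrow> ref \<rho> = ref \<rho>')"

definition pants_frames ::
    "('a::topological_space, 'z) marked_surface_scheme \<Rightarrow>
     ((real \<Rightarrow> 'a) set \<Rightarrow> mat3) \<Rightarrow> ((real \<Rightarrow> 'a) set \<Rightarrow> mat3) \<Rightarrow> (nat \<Rightarrow> mat3) \<Rightarrow> bool" where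
  "pants_frames M \<rho>\<^sub>0 \<rho> g \<longleftrightarrow>
     (\<forall>k<npants M. g k \<in> carrier SL3 \<and>
        (\<forall>x \<in> pants_group M k. \<rho> x = g k ** \<rho>\<^sub>0 x ** matrix_inv (g k)))"

definition gluing_matrix ::
    "('a, 'z) marked_surface_scheme \<Rightarrow> ((real \<Rightarrow> 'a) set \<Rightarrow> mat3) \<Rightarrow> ((real \<Rightarrow> 'a) set \<Rightarrow> mat3) \<Rightarrow>
     (nat \<Rightarrow> mat3) \<Rightarrow> nat \<Rightarrow> mat3 \<Rightarrow> bool" where
  "gluing_matrix M \<rho>\<^sub>0 \<rho> g j K \<longleftrightarrow>
     (let k = fst (side M j); k' = fst (side' M j);
          a = \<rho>\<^sub>0 (elt M (Bd (side M j))); d = elt M (St j)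
      in K \<in> carrier SL3 \<and> K ** a = a ** K \<and>
         (if j \<in> tree M then matrix_inv (g k) ** g k' = K
          else matrix_inv (g k') ** \<rho> d ** g k = \<rho>\<^sub>0 d ** K))"

text \<open>
  \<open>twist_bulge A K u v\<close>: in a basis of eigenvectors of \<open>A\<close>, ordered by decreasing absolute value of
  the eigenvalues, the eigenvalues of \<open>K\<close> are \<open>\<kappa>\<^sub>1 = e\<^sup>u\<^sup>-\<^sup>v\<close>, \<open>\<kappa>\<^sub>2 = e\<^sup>2\<^sup>v\<close> and hence \<open>\<kappa>\<^sub>3 = e\<^sup>-\<^sup>u\<^sup>-\<^sup>v\<close>. Here
  \<open>u = t + i\<theta>\<close> with \<open>\<theta>\<close> represented in \<open>[0, 2\<pi>)\<close> and \<open>v = s + i\<phi>\<close> with \<open>\<phi>\<close> represented in \<open>[0, \<pi>)\<close>.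
\<close>

definition twist_bulge :: "mat3 \<Rightarrow> mat3 \<Rightarrow> complex \<Rightarrow> complex \<Rightarrow> bool" where
  "twist_bulge A K u v \<longleftrightarrow>
     (\<exists>l1 l2 l3 x1 x2 x3. has_eigenpair A l1 x1 \<and> has_eigenpair A l2 x2 \<and> has_eigenpair A l3 x3 \<and>
        cmod l1 > cmod l2 \<and> cmod l2 > cmod l3 \<and>
        has_eigenpair K (exp (u - v)) x1 \<and> has_eigenpair K (exp (2 * v)) x2 \<and>
        has_eigenpair K (exp (- u - v)) x3) \<and>
     0 \<le> Im u \<and> Im u < 2 * pi \<and> 0 \<le> Im v \<and> Im v < pi"

text \<open>
  \<open>gluing_parameters M \<rho>\<^sub>0 \<rho> u v\<close>: for some admissible choice of the conjugating matrices \<open>g\<^sub>k\<close>, the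
  twist-bend and bulge-turn parameters of \<open>\<rho>\<close> relative to \<open>\<rho>\<^sub>0\<close> along the \<open>j\<close>-th curve are \<open>u j\<close> and
  \<open>v j\<close>. The \<open>g\<^sub>k\<close> are only unique up to cube roots of unity, so this is a relation.
\<close>

definition gluing_parameters ::
    "('a::topological_space, 'z) marked_surface_scheme \<Rightarrow>
     ((real \<Rightarrow> 'a) set \<Rightarrow> mat3) \<Rightarrow> ((real \<Rightarrow> 'a) set \<Rightarrow> mat3) \<Rightarrow>
     (nat \<Rightarrow> complex) \<Rightarrow> (nat \<Rightarrow> complex) \<Rightarrow> bool" where
  "gluing_parameters M \<rho>\<^sub>0 \<rho> u v \<longleftrightarrow>
     (\<exists>g. pants_frames M \<rho>\<^sub>0 \<rho> g \<and>
        (\<forall>j<ncurves M. \<exists>K. gluing_matrix M \<rho>\<^sub>0 \<rho> g j K \<and>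
           twist_bulge (\<rho>\<^sub>0 (elt M (Bd (side M j)))) K (u j) (v j)))"

definition same_gluing ::
    "('a::topological_space, 'z) marked_surface_scheme \<Rightarrow>
     (((real \<Rightarrow> 'a) set \<Rightarrow> mat3) \<Rightarrow> ((real \<Rightarrow> 'a) set \<Rightarrow> mat3)) \<Rightarrow>
     ((real \<Rightarrow> 'a) set \<Rightarrow> mat3) \<Rightarrow> ((real \<Rightarrow> 'a) set \<Rightarrow> mat3) \<Rightarrow> bool" where
  "same_gluing M ref \<rho> \<rho>' \<longleftrightarrow>
     (\<exists>u v. gluing_parameters M (ref \<rho>) \<rho> u v \<and> gluing_parameters M (ref \<rho>') \<rho>' u v)"

end

theory Submission
  imports Defs
begin

text \<open>
  Let \<open>(A, B)\<close> be an irreducible pair with \<open>A\<close> loxodromic, and make \<open>A\<close> diagonal, with distinct eigenvalues. The traces of \<open>A\<^sup>i B\<close> and \<open>A\<^sup>i B\<^sup>-\<^sup>1\<close> for \<open>i = -1, 0, 1\<close> give the diagonals of \<open>B\<close> and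
  \<open>B\<^sup>-\<^sup>1\<close> (a Vandermonde system), hence the products \<open>b\<^sub>i\<^sub>j b\<^sub>j\<^sub>i\<close>. Then \<open>det B = 1\<close> gives the sum of the two
  3-cycle products \<open>b\<^sub>1\<^sub>2 b\<^sub>2\<^sub>3 b\<^sub>3\<^sub>1\<close> and \<open>b\<^sub>1\<^sub>3 b\<^sub>3\<^sub>2 b\<^sub>2\<^sub>1\<close>, and \<open>tr[A, B]\<close> distinguishes them. By irreducibility the
  off-diagonal entries of \<open>B\<close> form a strongly connected digraph, so these cycle products determine \<open>B\<close>
  up to conjugation by a diagonal matrix.

  Hence two representations with equal data (1)-(3) are conjugate on every pair of pants, by \<open>g\<^sub>k\<close>; the
  gluing matrices commute with a loxodromic matrix, so they are determined by their eigenvalues, that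
  is, by the twist-bulge parameters. For two representations with equal parameters and frames \<open>g\<^sub>k\<close>
  and \<open>f\<^sub>k\<close>, equality of the gluing matrices makes \<open>f\<^sub>k g\<^sub>k\<^sup>-\<^sup>1\<close> constant along the spanning tree, and this
  constant conjugates the generators of all pants groups and all stable letters.
\<close>

section \<open>Matrices and conjugation\<close>

lemma matrix_inv_cancel:
  fixes A :: "'a::field^'n^'n"
  assumes "invertible A"
  shows "A ** matrix_inv A = mat 1" "matrix_inv A ** A = mat 1"
proof -
  have "\<exists>A'. A ** A' = mat 1 \<and> A' ** A = mat 1"
    using assms by (auto simp: invertible_def)
  then have "A ** matrix_inv A = mat 1 \<and> matrix_inv A ** A = mat 1"
    unfolding matrix_inv_def by (rule someI_ex)
  then show "A ** matrix_inv A = mat 1" "matrix_inv A ** A = mat 1" by auto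
qed

lemma matrix_inv_cancel_left:
  fixes A X :: "'a::field^'n^'n"
  assumes "invertible A"
  shows "A ** (matrix_inv A ** X) = X" "matrix_inv A ** (A ** X) = X"
  using matrix_inv_cancel[OF assms] by (simp_all add: matrix_mul_assoc)

lemma matrix_inv_eqI:
  fixes A B :: "'a::field^'n^'n"
  assumes "A ** B = mat 1"
  shows "matrix_inv A = B"
proof -
  have "invertible A"
    using assms invertible_right_inverse by blast
  then have "matrix_inv A = matrix_inv A ** (A ** B)"
    by (simp add: assms)
  then show ?thesis
    using matrix_inv_cancel_left(2)[OF \<open>invertible A\<close>] by simp
qed

lemma invertible_matrix_inv:
  fixes A :: "'a::field^'n^'n"
  assumes "invertible A"
  shows "invertible (matrix_inv A)"
  using matrix_inv_cancel[OF assms] by (auto simp: invertible_def)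

lemma matrix_inv_matrix_inv:
  fixes A :: "'a::field^'n^'n"
  assumes "invertible A"
  shows "matrix_inv (matrix_inv A) = A"
  by (intro matrix_inv_eqI matrix_inv_cancel assms)

lemma matrix_inv_mult:
  fixes A B :: "'a::field^'n^'n"
  assumes "invertible A" "invertible B"
  shows "matrix_inv (A ** B) = matrix_inv B ** matrix_inv A"
  by (intro matrix_inv_eqI)
     (simp add: assms matrix_inv_cancel matrix_inv_cancel_left flip: matrix_mul_assoc)

text \<open>A group normal form for words in invertible matrices. It is mostly used with products
  associated to the right, where \<open>matrix_inv_cancel_left\<close> cancels neighbours inside a
  longer word.\<close>

lemmas matrix_group_simps =
  matrix_inv_cancel matrix_inv_cancel_left matrix_inv_matrix_inv matrix_inv_mult
  invertible_matrix_inv invertible_mult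

text \<open>The gluing relation sends \<open>a\<close> to a conjugate of its inverse, so commutation
  of a gluing matrix is first found with the inverse and has to be carried back.\<close>

lemma matrix_commute_inv:
  fixes A K :: "'a::field^'n^'n"
  assumes "invertible A" "K ** matrix_inv A = matrix_inv A ** K"
  shows "K ** A = A ** K"
proof -
  have "A ** (K ** matrix_inv A) ** A = A ** (matrix_inv A ** K) ** A"
    by (simp add: assms(2))
  then show ?thesis
    by (simp add: assms(1) matrix_group_simps flip: matrix_mul_assoc)
qed

lemma carrier_SL3: "A \<in> carrier SL3 \<longleftrightarrow> det A = 1"
  by (simp add: SL3_def)

lemma SL3_simps: "A \<otimes>\<^bsub>SL3\<^esub> B = A ** B" "\<one>\<^bsub>SL3\<^esub> = mat 1"
  by (simp_all add: SL3_def)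

lemma invertible_SL3: "A \<in> carrier SL3 \<Longrightarrow> invertible A"
  by (simp add: carrier_SL3 invertible_det_nz)

lemma SL3_closed:
  shows "mat 1 \<in> carrier SL3"
    and "A \<in> carrier SL3 \<Longrightarrow> B \<in> carrier SL3 \<Longrightarrow> A ** B \<in> carrier SL3"
    and "A \<in> carrier SL3 \<Longrightarrow> matrix_inv A \<in> carrier SL3"
proof -
  assume "A \<in> carrier SL3"
  then have "det (A ** matrix_inv A) = 1" "det A = 1"
    by (simp_all add: matrix_inv_cancel invertible_SL3) (simp add: carrier_SL3)
  then show "matrix_inv A \<in> carrier SL3" by (simp add: carrier_SL3 det_mul)
qed (simp_all add: carrier_SL3 det_mul)

lemma group_SL3: "group SL3"
proof (rule groupI)
  fix A assume "A \<in> carrier SL3"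
  then show "\<exists>B\<in>carrier SL3. B \<otimes>\<^bsub>SL3\<^esub> A = \<one>\<^bsub>SL3\<^esub>"
    using SL3_closed(3) matrix_inv_cancel(2)[OF invertible_SL3] by (auto simp: SL3_simps)
qed (auto simp: SL3_simps SL3_closed matrix_mul_assoc)

definition conj_by :: "'a::field^'n^'n \<Rightarrow> 'a^'n^'n \<Rightarrow> 'a^'n^'n" where
  "conj_by P X = P ** X ** matrix_inv P"

lemma conj_by_conj_by:
  assumes "invertible P" "invertible Q"
  shows "conj_by P (conj_by Q X) = conj_by (P ** Q) X"
  by (simp add: conj_by_def assms matrix_group_simps matrix_mul_assoc)

lemma conj_by_inv_cancel:
  assumes "invertible P"
  shows "conj_by (matrix_inv P) (conj_by P X) = X" "conj_by P (conj_by (matrix_inv P) X) = X"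
  by (simp_all add: conj_by_def assms matrix_group_simps flip: matrix_mul_assoc)

lemma conj_by_mult:
  assumes "invertible P"
  shows "conj_by P X ** conj_by P Y = conj_by P (X ** Y)"
  by (simp add: conj_by_def assms matrix_group_simps flip: matrix_mul_assoc)

lemma matrix_inv_conj_by:
  assumes "invertible P" "invertible X"
  shows "matrix_inv (conj_by P X) = conj_by P (matrix_inv X)"
  by (simp add: conj_by_def assms matrix_group_simps flip: matrix_mul_assoc)

lemma conj_by_one: "invertible P \<Longrightarrow> conj_by P (mat 1) = mat 1"
  by (simp add: conj_by_def matrix_inv_cancel)

lemma trace_conj_by: "invertible P \<Longrightarrow> trace (conj_by P X) = trace X"
  using trace_mul_sym[of "P ** X" "matrix_inv P"] by (simp add: conj_by_def matrix_group_simps)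

lemma det_conj_by:
  assumes "invertible P"
  shows "det (conj_by P X) = det X"
proof -
  have "det P * det (matrix_inv P) = 1"
    using matrix_inv_cancel(1)[OF assms] by (metis det_mul det_I)
  then show ?thesis by (simp add: conj_by_def det_mul)
qed

section \<open>Pairs of matrices in SL(3,C)\<close>

definition diag :: "'a::zero^'n \<Rightarrow> 'a^'n^'n" where
  "diag l = (\<chi> i j. if i = j then l $ i else 0)"

lemma diag_nth: "diag l $ i $ j = (if i = j then l $ i else 0)"
  by (simp add: diag_def)

lemma trace_diag: "trace (diag l) = (\<Sum>i\<in>UNIV. l $ i)"
  by (simp add: trace_def diag_nth)

lemma diag_mult_nth:
  fixes l :: "'a::semiring_1^'n"
  shows "(diag l ** X) $ i $ j = l $ i * X $ i $ j"
    and "(Y ** diag l) $ j $ i = Y $ j $ i * l $ i"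
  by (simp_all add: diag_def matrix_matrix_mult_def if_distrib[where f="\<lambda>x. x * _"]
      if_distrib[where f="\<lambda>x. _ * x"] sum.delta sum.delta' cong: if_cong)

lemma det_diag: "det (diag l) = prod (\<lambda>i. l $ i) UNIV"
  by (subst det_diagonal) (simp_all add: diag_def)

lemma prod_UNIV_3: "prod f (UNIV::3 set) = f 1 * f 2 * f 3"
  unfolding UNIV_3 by (simp add: ac_simps)

lemma invertible_diag3: "invertible (diag l :: mat3) \<longleftrightarrow> (\<forall>i. l $ i \<noteq> 0)"
  by (simp add: invertible_det_nz det_diag)

lemma matrix_inv_diag:
  fixes l :: "complex^'n"
  assumes "\<And>i. l $ i \<noteq> 0"
  shows "matrix_inv (diag l) = diag (\<chi> i. inverse (l $ i))"
proof (rule matrix_inv_eqI)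
  have "(diag l ** diag (\<chi> i. inverse (l $ i))) $ i $ j = mat 1 $ i $ j" for i j
    unfolding diag_mult_nth using assms by (simp add: diag_def mat_def)
  then show "diag l ** diag (\<chi> i. inverse (l $ i)) = mat 1"
    by (simp add: vec_eq_iff)
qed

text \<open>This is the adjugate: at determinant 1 the inverse is polynomial in the entries, so
  trace identities involving it can be checked by expansion.\<close>

lemma matrix_inv_SL3:
  assumes "det (B :: mat3) = 1"
  shows "matrix_inv B = vector
    [vector [B$2$2*B$3$3 - B$2$3*B$3$2, B$1$3*B$3$2 - B$1$2*B$3$3, B$1$2*B$2$3 - B$1$3*B$2$2],
     vector [B$2$3*B$3$1 - B$2$1*B$3$3, B$1$1*B$3$3 - B$1$3*B$3$1, B$1$3*B$2$1 - B$1$1*B$2$3],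
     vector [B$2$1*B$3$2 - B$2$2*B$3$1, B$1$2*B$3$1 - B$1$1*B$3$2, B$1$1*B$2$2 - B$1$2*B$2$1]]"
  using assms
  by (intro matrix_inv_eqI)
     (simp add: vec_eq_iff forall_3 matrix_matrix_mult_def sum_3 mat_def det_3 algebra_simps)

text \<open>The exponents 0, 1, -1 form a Vandermonde system once the last equation is multiplied by
  \<open>l$1*l$2*l$3\<close>.\<close>

lemma vandermonde3:
  fixes l x :: "complex^3"
  assumes l: "\<And>i. l $ i \<noteq> 0" "l$1 \<noteq> l$2" "l$2 \<noteq> l$3" "l$1 \<noteq> l$3"
    and "(\<Sum>i\<in>UNIV. x $ i) = 0" "(\<Sum>i\<in>UNIV. l $ i * x $ i) = 0" "(\<Sum>i\<in>UNIV. inverse (l $ i) * x $ i) = 0"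
  shows "x = 0"
proof -
  have nz: "l$1 \<noteq> 0" "l$2 \<noteq> 0" "l$3 \<noteq> 0" using l by auto
  have s: "x$1 + x$2 + x$3 = 0" "l$1*x$1 + l$2*x$2 + l$3*x$3 = 0"
    "l$2*l$3*x$1 + l$1*l$3*x$2 + l$1*l$2*x$3 = 0"
    using assms(5-7) nz by (simp_all add: sum_3 field_simps)
  \<comment> \<open>For the first component: \<open>l$1\<close> times the second equation, plus the
    third, minus \<open>l$1*(l$2+l$3)\<close> times the first. The others are symmetric.\<close>
  have "(l$1-l$2)*(l$1-l$3)*x$1 = 0" "(l$2-l$1)*(l$2-l$3)*x$2 = 0" "(l$3-l$1)*(l$3-l$2)*x$3 = 0"
    using s nz by algebra+
  then show ?thesis using l by (simp add: vec_eq_iff forall_3)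
qed

text \<open>Read nonzero off-diagonal entries as edges of a digraph. The hypotheses
  \<open>nz\<close> give a path a, b, c and a way back to a, either directly or through b. The
  entries of \<open>e\<close> are forced along the path up to a common factor, and the cycle
  products then fix the remaining entries.\<close>

lemma cycles_determine_matrix:
  fixes B B' :: "complex^'n^'n"
  assumes abc: "UNIV = {a, b, c}" "a \<noteq> b" "b \<noteq> c" "a \<noteq> c"
    and c1: "\<And>i. B$i$i = B'$i$i"
    and c2: "\<And>i j. B$i$j * B$j$i = B'$i$j * B'$j$i"
    and c3: "\<And>i j k. B$i$j * B$j$k * B$k$i = B'$i$j * B'$j$k * B'$k$i"
    and nz: "B$a$b \<noteq> 0" "B$b$c \<noteq> 0" "B$c$a \<noteq> 0 \<or> B$b$a \<noteq> 0 \<and> B$c$b \<noteq> 0"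
  shows "\<exists>e. (\<forall>i. e $ i \<noteq> 0) \<and> (\<forall>i j. e $ i * B$i$j = B'$i$j * e $ j)"
proof -
  \<comment> \<open>Both path edges lie on nonzero cycles: the 3-cycle if c returns directly to a,
    otherwise two 2-cycles. Equal products make the edges nonzero in \<open>B'\<close> too.\<close>
  have nz': "B'$a$b \<noteq> 0" "B'$b$c \<noteq> 0"
    using nz c3[of a b c] c2[of a b] c2[of b c] by auto
  \<comment> \<open>Normalised to 1 at a; the equations for the entries (a,b) and (b,c) dictate the
    other two values.\<close>
  define e where "e = (\<chi> i. if i = a then 1 else if i = b then B$a$b / B'$a$b
     else B$a$b * B$b$c / (B'$a$b * B'$b$c))"
  have e: "e$a = 1" "e$b = B$a$b / B'$a$b" "e$c = B$a$b * B$b$c / (B'$a$b * B'$b$c)"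
    using abc by (auto simp: e_def)
  have ex: "(\<forall>i. P i) \<longleftrightarrow> P a \<and> P b \<and> P c" for P
    using abc(1) by (metis UNIV_I insertE singletonD)
  have "e$b * B$b$a = B'$b$a * e$a"
    using nz nz' c2[of a b] by (simp add: e field_simps)
  moreover have "e$c * B$c$b = B'$c$b * e$b"
    using nz nz' c2[of b c] by (simp add: e field_simps)
  moreover have "e$c * B$c$a = B'$c$a * e$a"
    using nz nz' c3[of a b c] by (simp add: e field_simps)
  moreover have "e$a * B$a$c = B'$a$c * e$c"
  proof -
    \<comment> \<open>The edge from a to c closes no cycle with the path. It is compared by
      completing it with a nonzero return route from c to a and cancelling that route.\<close>
    have "B'$a$b * B'$b$c * B$a$c = B'$a$c * B$a$b * B$b$c"
    proof (cases "B$c$a = 0")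
      case False
      have *: "B$a$b * B$b$c * B$c$a = B'$a$b * B'$b$c * B'$c$a" "B$a$c * B$c$a = B'$a$c * B'$c$a"
        using c3[of a b c] c2[of a c] by (simp_all add: mult_ac)
      then have "B$c$a * (B'$a$b * B'$b$c * B$a$c) = B$c$a * (B'$a$c * B$a$b * B$b$c)"
        by algebra
      then show ?thesis using False by simp
    next
      case True
      then have n: "B$b$a \<noteq> 0" "B$c$b \<noteq> 0" using nz(3) by auto
      have *: "B$a$c * B$c$b * B$b$a = B'$a$c * B'$c$b * B'$b$a" "B$a$b * B$b$a = B'$a$b * B'$b$a"
        "B$b$c * B$c$b = B'$b$c * B'$c$b"
        using c3[of a c b] c2[of a b] c2[of b c] by (simp_all add: mult_ac)
      have "B$b$a * B$c$b * (B'$a$b * B'$b$c * B$a$c) = B'$a$b * B'$b$c * (B'$a$c * B'$c$b * B'$b$a)"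
        unfolding *(1)[symmetric] by (simp add: mult_ac)
      also have "\<dots> = B'$a$c * (B'$a$b * B'$b$a) * (B'$b$c * B'$c$b)"
        by (simp add: mult_ac)
      also have "\<dots> = B$b$a * B$c$b * (B'$a$c * B$a$b * B$b$c)"
        unfolding *(2,3)[symmetric] by (simp add: mult_ac)
      finally show ?thesis using n by simp
    qed
    then show ?thesis using nz' by (simp add: e field_simps)
  qed
  moreover have "e$a * B$a$b = B'$a$b * e$b" "e$b * B$b$c = B'$b$c * e$c"
    using nz nz' by (simp_all add: e field_simps)
  moreover have "e$i * B$i$i = B'$i$i * e$i" for i
    by (simp add: c1)
  moreover have "e$a \<noteq> 0" "e$b \<noteq> 0" "e$c \<noteq> 0"
    using nz nz' by (simp_all add: e)
  ultimately have "(\<forall>i. e $ i \<noteq> 0) \<and> (\<forall>i j. e $ i * B$i$j = B'$i$j * e $ j)"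
    unfolding ex by blast
  then show ?thesis by blast
qed

text \<open>The hypothesis \<open>irr\<close> says that no coordinate subspace spanned by a nonempty
  proper index set \<open>I\<close> is invariant under \<open>B\<close>; \<open>k\<close> only
  witnesses that \<open>I\<close> is proper. It yields strong connectedness of the digraph, while
  the traces supply the cycle products.\<close>

lemma diagonal_pair_conjugate:
  fixes B B' :: mat3 and l :: "complex^3"
  assumes l: "\<And>i. l $ i \<noteq> 0" "l$1 \<noteq> l$2" "l$2 \<noteq> l$3" "l$1 \<noteq> l$3"
    and det: "det B = 1" "det B' = 1"
    and B: "trace B = trace B'" "trace (diag l ** B) = trace (diag l ** B')"
      "trace (matrix_inv (diag l) ** B) = trace (matrix_inv (diag l) ** B')"
    and C: "trace (matrix_inv B) = trace (matrix_inv B')"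
      "trace (diag l ** matrix_inv B) = trace (diag l ** matrix_inv B')"
      "trace (matrix_inv (diag l) ** matrix_inv B) = trace (matrix_inv (diag l) ** matrix_inv B')"
    and comm: "commutator_trace (diag l) B = commutator_trace (diag l) B'"
    and irr: "\<And>I k. I \<noteq> {} \<Longrightarrow> k \<notin> I \<Longrightarrow> \<exists>j\<in>I. \<exists>i. i \<notin> I \<and> B$i$j \<noteq> 0"
  shows "\<exists>e. (\<forall>i. e $ i \<noteq> 0) \<and> (\<forall>i j. e $ i * B$i$j = B'$i$j * e $ j)"
proof -
  have key: "\<forall>i. X$i$i = Y$i$i"
    if "trace X = trace Y" "trace (diag l ** X) = trace (diag l ** Y)"
       "trace (matrix_inv (diag l) ** X) = trace (matrix_inv (diag l) ** Y)" for X Y :: mat3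
  proof -
    have "(\<chi> i. X$i$i - Y$i$i) = 0"
      using that by (intro vandermonde3[OF l])
        (simp_all add: trace_def matrix_inv_diag l diag_mult_nth sum_subtractf right_diff_distrib)
    then show ?thesis by (simp add: vec_eq_iff)
  qed
  have bd: "B'$i$i = B$i$i" for i using key[OF B] by simp
  have cd: "matrix_inv B'$i$i = matrix_inv B$i$i" for i using key[OF C] by simp
  \<comment> \<open>A diagonal entry of the inverse is the complementary 2x2 minor; once the
    diagonals agree, what is left of it is a product of two opposite entries.\<close>
  have p: "B'$1$2*B'$2$1 = B$1$2*B$2$1" "B'$1$3*B'$3$1 = B$1$3*B$3$1" "B'$2$3*B'$3$2 = B$2$3*B$3$2"
    using cd[of 1] cd[of 2] cd[of 3] by (simp_all add: matrix_inv_SL3 det bd)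
  define q1 q2 q1' q2' where q: "q1 = B$1$2*B$2$3*B$3$1" "q2 = B$1$3*B$3$2*B$2$1"
     "q1' = B'$1$2*B'$2$3*B'$3$1" "q2' = B'$1$3*B'$3$2*B'$2$1"
  have det': "X$1$1*X$2$2*X$3$3 - X$1$1*(X$2$3*X$3$2) - X$2$2*(X$1$3*X$3$1) - X$3$3*(X$1$2*X$2$1)
      + (X$1$2*X$2$3*X$3$1 + X$1$3*X$3$2*X$2$1) = 1" if "det X = 1" for X :: mat3
    using that by (simp add: det_3 algebra_simps)
  have qs: "q1 + q2 = q1' + q2'"
    using det'[OF det(1)] det'[OF det(2)] unfolding bd p q[symmetric] by (metis add_left_cancel)
  define m where "m i = inverse (l$i)" for i
  \<comment> \<open>The trace is the sum of \<open>l$i * m j * X$i$j\<close> times the (j,i) entry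
    of the inverse. For distinct i and j, that cofactor completes \<open>X$i$j\<close> to a 2-cycle
    and to a 3-cycle; the two orientations of the 3-cycle receive different coefficients.\<close>
  have cm: "commutator_trace (diag l) X = (\<Sum>i\<in>UNIV. X$i$i * matrix_inv X$i$i)
      - (l$1*m 2 + l$2*m 1) * X$3$3 * (X$1$2*X$2$1)
      - (l$1*m 3 + l$3*m 1) * X$2$2 * (X$1$3*X$3$1)
      - (l$2*m 3 + l$3*m 2) * X$1$1 * (X$2$3*X$3$2)
      + (l$1*m 2 + l$2*m 3 + l$3*m 1) * (X$1$2*X$2$3*X$3$1)
      + (l$2*m 1 + l$3*m 2 + l$1*m 3) * (X$1$3*X$3$2*X$2$1)" if "det X = 1" for X :: mat3
  proof -
    have lm: "l$i * m i = 1" for i using l(1) by (simp add: m_def)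
    have "commutator_trace (diag l) X = (\<Sum>i\<in>UNIV. \<Sum>j\<in>UNIV. l$i * X$i$j * m j * matrix_inv X$j$i)"
      by (simp add: commutator_trace_def trace_def matrix_inv_diag l matrix_matrix_mult_def[of _ "matrix_inv X"] diag_mult_nth m_def)
    also have "\<dots> = (\<Sum>i\<in>UNIV. (l$i * m i) * X$i$i * matrix_inv X$i$i)
      - (l$1*m 2 + l$2*m 1) * X$3$3 * (X$1$2*X$2$1)
      - (l$1*m 3 + l$3*m 1) * X$2$2 * (X$1$3*X$3$1)
      - (l$2*m 3 + l$3*m 2) * X$1$1 * (X$2$3*X$3$2)
      + (l$1*m 2 + l$2*m 3 + l$3*m 1) * (X$1$2*X$2$3*X$3$1)
      + (l$2*m 1 + l$3*m 2 + l$1*m 3) * (X$1$3*X$3$2*X$2$1)"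
      by (simp add: sum_3 matrix_inv_SL3 that algebra_simps)
    finally show ?thesis by (simp add: lm)
  qed
  have "(l$1*m 2 + l$2*m 3 + l$3*m 1) * q1 + (l$2*m 1 + l$3*m 2 + l$1*m 3) * q2
      = (l$1*m 2 + l$2*m 3 + l$3*m 1) * q1' + (l$2*m 1 + l$3*m 2 + l$1*m 3) * q2'"
    using comm unfolding cm[OF det(1)] cm[OF det(2)] by (simp add: q bd cd p)
  moreover have "q2 = q1' + q2' - q1" using qs by algebra
  ultimately have "(q1 - q1') * ((l$1*m 2 + l$2*m 3 + l$3*m 1) - (l$2*m 1 + l$3*m 2 + l$1*m 3)) = 0"
    by algebra
  \<comment> \<open>The difference of the two coefficients is a Vandermonde product, nonzero for
    distinct eigenvalues; with the sum \<open>q1 + q2\<close> already known, this separates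
    \<open>q1\<close> from \<open>q2\<close>.\<close>
  moreover have "(l$1*m 2 + l$2*m 3 + l$3*m 1) - (l$2*m 1 + l$3*m 2 + l$1*m 3)
      = - (l$1-l$2)*(l$2-l$3)*(l$1-l$3) / (l$1*l$2*l$3)"
    using l(1) by (simp add: m_def field_simps)
  ultimately have q1: "q1 = q1'" using l by simp
  then have q2: "q2 = q2'" using qs by simp
  have c1: "B$i$i = B'$i$i" for i by (simp add: bd)
  have c2: "\<forall>i j. B$i$j * B$j$i = B'$i$j * B'$j$i"
    using p by (simp add: forall_3 bd mult_ac)
  have c3: "\<forall>i j k. B$i$j * B$j$k * B$k$i = B'$i$j * B'$j$k * B'$k$i"
    using p q1 q2 unfolding forall_3 bd q by (simp add: bd mult_ac)
  note cyc = cycles_determine_matrix[OF _ _ _ _ c1 c2[rule_format] c3[rule_format]]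
  have U: "UNIV = {1,2,3::3}" "UNIV = {1,3,2::3}" "UNIV = {2,1,3::3}"
    unfolding UNIV_3 by auto
  have i3: "(\<exists>i::3. P i) \<longleftrightarrow> P 1 \<or> P 2 \<or> P 3" for P
    using forall_3[of "\<lambda>i. \<not> P i"] by auto
  have "B$2$1 \<noteq> 0 \<or> B$3$1 \<noteq> 0" "B$1$2 \<noteq> 0 \<or> B$3$2 \<noteq> 0" "B$1$3 \<noteq> 0 \<or> B$2$3 \<noteq> 0"
    "B$1$2 \<noteq> 0 \<or> B$1$3 \<noteq> 0" "B$2$1 \<noteq> 0 \<or> B$2$3 \<noteq> 0" "B$3$1 \<noteq> 0 \<or> B$3$2 \<noteq> 0"
    using irr[of "{1}" 2] irr[of "{2}" 1] irr[of "{3}" 1] irr[of "{2,3}" 1] irr[of "{1,3}" 2] irr[of "{1,2}" 3]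
    unfolding i3 by auto
  \<comment> \<open>Every row and every column now has a nonzero off-diagonal entry. There is one
    case for each middle vertex 2, 3, 1 of the path; 3-cycles of both orientations are
    covered.\<close>
  then consider "B$1$2 \<noteq> 0" "B$2$3 \<noteq> 0" "B$3$1 \<noteq> 0 \<or> B$2$1 \<noteq> 0 \<and> B$3$2 \<noteq> 0"
    | "B$1$3 \<noteq> 0" "B$3$2 \<noteq> 0" "B$2$1 \<noteq> 0 \<or> B$3$1 \<noteq> 0 \<and> B$2$3 \<noteq> 0"
    | "B$2$1 \<noteq> 0" "B$1$3 \<noteq> 0" "B$3$2 \<noteq> 0 \<or> B$1$2 \<noteq> 0 \<and> B$3$1 \<noteq> 0"
    by blast
  then show ?thesis
    by cases (rule cyc[OF U(1)] cyc[OF U(2)] cyc[OF U(3)]; simp)+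
qed

section \<open>Diagonalisation of strongly loxodromic matrices\<close>

definition col_matrix :: "('n \<Rightarrow> 'a^'m) \<Rightarrow> 'a^'n^'m" where
  "col_matrix x = (\<chi> i j. x j $ i)"

lemma eigenvectors_iff:
  fixes A :: "'a::field^'n^'n"
  shows "A ** col_matrix x = col_matrix x ** diag l \<longleftrightarrow> (\<forall>j. A *v x j = l $ j *s x j)"
proof -
  have "(A ** col_matrix x) $ i $ j = (A *v x j) $ i" for i j
    by (simp add: col_matrix_def matrix_matrix_mult_def matrix_vector_mult_def)
  moreover have "(col_matrix x ** diag l) $ i $ j = (l $ j *s x j) $ i" for i j
    unfolding diag_mult_nth by (simp add: col_matrix_def mult.commute)
  ultimately show ?thesis
    by (auto simp: vec_eq_iff)
qed

text \<open>Since \<open>A ** P = P ** diag l\<close>, the kernel of \<open>P\<close> is stable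
  under \<open>diag l\<close>. For a kernel vector \<open>c\<close>, the equations for
  \<open>c\<close> and its first two images form a Vandermonde system in the vectors
  \<open>c$k * x k\<close>, which therefore vanish.\<close>

lemma invertible_eigenvectors:
  fixes A :: mat3 and x :: "3 \<Rightarrow> complex^3"
  assumes "\<And>i. has_eigenpair A (l $ i) (x i)" and l: "l$1 \<noteq> l$2" "l$2 \<noteq> l$3" "l$1 \<noteq> l$3"
  shows "invertible (col_matrix x)"
proof -
  define P where "P = col_matrix x"
  have AP: "A ** P = P ** diag l"
    using assms(1) by (simp add: P_def eigenvectors_iff has_eigenpair_def)
  have x: "x i \<noteq> 0" for i using assms(1)[of i] by (simp add: has_eigenpair_def)
  have "c = 0" if c: "P *v c = 0" for c
  proof -
    have 1: "P *v (diag l *v d) = 0" if "P *v d = 0" for d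
      using that AP by (metis matrix_vector_mul_assoc matrix_vector_mult_0_right)
    have D: "(diag l *v d) $ i = l $ i * d $ i" for d i
      by (simp add: diag_def matrix_vector_mult_def if_distrib[where f="\<lambda>x. x * _"] cong: if_cong)
    have S: "(P *v d) $ i = x 1 $ i * d $ 1 + x 2 $ i * d $ 2 + x 3 $ i * d $ 3" for d :: "complex^3" and i
      by (simp add: P_def col_matrix_def matrix_vector_mult_def sum_3)
    have z: "c$1 * x 1 $ i = 0 \<and> c$2 * x 2 $ i = 0 \<and> c$3 * x 3 $ i = 0" for i
    proof -
      have e: "x 1 $ i * c$1 + x 2 $ i * c$2 + x 3 $ i * c$3 = 0"
        "x 1 $ i * (l$1 * c$1) + x 2 $ i * (l$2 * c$2) + x 3 $ i * (l$3 * c$3) = 0"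
        "x 1 $ i * (l$1 * (l$1 * c$1)) + x 2 $ i * (l$2 * (l$2 * c$2)) + x 3 $ i * (l$3 * (l$3 * c$3)) = 0"
        using S[of c i, unfolded c] S[of "diag l *v c" i, unfolded 1[OF c]]
          S[of "diag l *v (diag l *v c)" i, unfolded 1[OF 1[OF c]]]
        by (simp_all only: D zero_index)
      have "(l$1-l$2)*(l$1-l$3)*(c$1 * x 1 $ i) = 0" "(l$2-l$1)*(l$2-l$3)*(c$2 * x 2 $ i) = 0"
        "(l$3-l$1)*(l$3-l$2)*(c$3 * x 3 $ i) = 0"
        using e by algebra+
      then show ?thesis using l by auto
    qed
    have "c$k = 0" if "\<And>i. c$k * x k $ i = 0" for k
      using that x[of k] by (auto simp: vec_eq_iff)
    then have "c$1 = 0" "c$2 = 0" "c$3 = 0" using z by blast+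
    then show "c = 0" by (simp add: vec_eq_iff forall_3)
  qed
  then show ?thesis
    unfolding P_def[symmetric] invertible_left_inverse matrix_left_invertible_ker by blast
qed

text \<open>A strict order by modulus makes the eigenvalues distinct and removes the freedom to
  permute them, so that the characteristic polynomial determines the vector itself.\<close>

definition decreasing_mod :: "complex^3 \<Rightarrow> bool" where
  "decreasing_mod l \<longleftrightarrow> cmod (l$1) > cmod (l$2) \<and> cmod (l$2) > cmod (l$3)"

lemma decreasing_mod_distinct:
  "decreasing_mod l \<Longrightarrow> l$1 \<noteq> l$2 \<and> l$2 \<noteq> l$3 \<and> l$1 \<noteq> l$3"
  by (auto simp: decreasing_mod_def)

lemma strongly_loxodromic_eigenvectors:
  assumes "strongly_loxodromic A"
  obtains l and x :: "3 \<Rightarrow> complex^3" where "decreasing_mod l" "\<And>i. has_eigenpair A (l $ i) (x i)"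
proof -
  obtain l1 l2 l3 x1 x2 x3 where e: "has_eigenpair A l1 x1" "has_eigenpair A l2 x2" "has_eigenpair A l3 x3"
    "cmod l1 > cmod l2" "cmod l2 > cmod l3"
    using assms unfolding strongly_loxodromic_def by blast
  define l :: "complex^3" where "l = vector [l1, l2, l3]"
  define x :: "3 \<Rightarrow> complex^3" where "x i = (if i = 1 then x1 else if i = 2 then x2 else x3)" for i
  have "decreasing_mod l" using e by (simp add: decreasing_mod_def l_def)
  moreover have "\<forall>i. has_eigenpair A (l $ i) (x i)"
    using e by (simp add: forall_3 l_def x_def)
  ultimately show thesis using that by blast
qed

lemma eigenvectors_conj_by:
  fixes A :: mat3 and x :: "3 \<Rightarrow> complex^3"
  assumes "decreasing_mod l" "\<And>i. has_eigenpair A (l $ i) (x i)"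
  shows "invertible (col_matrix x)" "A = conj_by (col_matrix x) (diag l)"
proof -
  show inv: "invertible (col_matrix x)"
    using assms decreasing_mod_distinct by (intro invertible_eigenvectors) auto
  have "A ** col_matrix x = col_matrix x ** diag l"
    using assms(2) by (simp add: eigenvectors_iff has_eigenpair_def)
  then have "A ** (col_matrix x ** matrix_inv (col_matrix x)) = conj_by (col_matrix x) (diag l)"
    by (simp add: conj_by_def matrix_mul_assoc)
  then show "A = conj_by (col_matrix x) (diag l)"
    by (simp add: inv matrix_group_simps)
qed

lemma strongly_loxodromic_diagonalize:
  assumes "strongly_loxodromic A"
  obtains P l where "invertible P" "decreasing_mod l" "A = conj_by P (diag l)" "\<And>i. l $ i \<noteq> 0"
proof -
  obtain l and x :: "3 \<Rightarrow> complex^3" where l: "decreasing_mod l" "\<And>i. has_eigenpair A (l $ i) (x i)"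
    using strongly_loxodromic_eigenvectors[OF assms] by blast
  note P = eigenvectors_conj_by[OF l]
  have "det (diag l) = 1"
    using assms det_conj_by[OF P(1), of "diag l"]
    by (simp add: strongly_loxodromic_def carrier_SL3 flip: P(2))
  then have "\<And>i. l $ i \<noteq> 0"
    using invertible_diag3[of l] by (simp add: invertible_det_nz)
  with l(1) P show thesis using that by blast
qed

text \<open>Sum, product and sum of inverses give all three elementary symmetric functions, the
  middle one being the product times the sum of inverses. Hence the root sets coincide, and the
  ordering matches the roots.\<close>

lemma decreasing_mod_unique:
  assumes l: "decreasing_mod l" "\<And>i. l $ i \<noteq> 0" and m: "decreasing_mod m" "\<And>i. m $ i \<noteq> 0"
    and "(\<Sum>i\<in>UNIV. l $ i) = (\<Sum>i\<in>UNIV. m $ i)" "(\<Prod>i\<in>UNIV. l $ i) = (\<Prod>i\<in>UNIV. m $ i)"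
    and "(\<Sum>i\<in>UNIV. inverse (l $ i)) = (\<Sum>i\<in>UNIV. inverse (m $ i))"
  shows "l = m"
proof -
  have e2: "x$1*x$2 + x$1*x$3 + x$2*x$3 = (\<Prod>i\<in>UNIV. x $ i) * (\<Sum>i\<in>UNIV. inverse (x $ i))"
    if "\<And>i. x $ i \<noteq> 0" for x :: "complex^3"
    using that by (simp add: sum_3 prod_UNIV_3 field_simps)
  have s: "l$1 + l$2 + l$3 = m$1 + m$2 + m$3" "l$1*l$2*l$3 = m$1*m$2*m$3"
    "l$1*l$2 + l$1*l$3 + l$2*l$3 = m$1*m$2 + m$1*m$3 + m$2*m$3"
    using assms(5,6,7) by (simp_all only: e2[OF l(2)] e2[OF m(2)]) (simp_all add: sum_3 prod_UNIV_3)
  have "(l$1-m$1)*(l$1-m$2)*(l$1-m$3) = 0" "(l$2-m$1)*(l$2-m$2)*(l$2-m$3) = 0"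
    "(l$3-m$1)*(l$3-m$2)*(l$3-m$3) = 0"
    using s by algebra+
  then have "l$1 = m$1 \<and> l$2 = m$2 \<and> l$3 = m$3"
    using l(1) m(1) unfolding decreasing_mod_def by auto
  then show ?thesis by (simp add: vec_eq_iff forall_3)
qed

lemma loxodromic_same_eigenvalues:
  assumes "invertible P" "decreasing_mod l" "\<And>i. l $ i \<noteq> 0"
    and "invertible Q" "decreasing_mod m" "\<And>i. m $ i \<noteq> 0"
    and "det (conj_by P (diag l)) = det (conj_by Q (diag m))"
    and "trace (conj_by P (diag l)) = trace (conj_by Q (diag m))"
    and "trace (matrix_inv (conj_by P (diag l))) = trace (matrix_inv (conj_by Q (diag m)))"
  shows "l = m"
proof -
  have "(\<Prod>i\<in>UNIV. l $ i) = (\<Prod>i\<in>UNIV. m $ i)"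
    using assms(7) by (simp add: det_conj_by assms(1,4) det_diag)
  moreover have "trace (diag l) = trace (diag m)"
    using assms(8) by (simp add: trace_conj_by assms(1,4))
  moreover have "trace (matrix_inv (diag l)) = trace (matrix_inv (diag m))"
    using assms(9) by (simp add: matrix_inv_conj_by invertible_diag3 trace_conj_by assms(1,3,4,6))
  ultimately show ?thesis
    by (intro decreasing_mod_unique[OF assms(2,3,5,6)])
       (simp_all add: trace_diag matrix_inv_diag[OF assms(3)] matrix_inv_diag[OF assms(6)])
qed

section \<open>Invariant subspaces and conjugacy of irreducible pairs\<close>

definition preserved_by :: "mat3 \<Rightarrow> (complex^3) set \<Rightarrow> bool" where
  "preserved_by A V \<longleftrightarrow> (\<forall>v\<in>V. A *v v \<in> V)"

text \<open>An injective map preserves dimension, so it carries an invariant subspace onto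
  itself.\<close>

lemma preserved_by_inv:
  assumes "vec.subspace V" "invertible A" "preserved_by A V"
  shows "preserved_by (matrix_inv A) V"
proof -
  have "(*v) A ` V = V"
  proof (rule vec.subspace_dim_equal)
    show "vec.dim ((*v) A ` V) \<ge> vec.dim V"
      using assms inj_matrix_vector_mult
      by (subst vec.dim_image_eq) (auto simp: inj_on_def)
  qed (use assms in \<open>auto simp: preserved_by_def vec.subspace_image\<close>)
  moreover have "matrix_inv A *v (A *v v) = v" for v
    using assms(2) by (simp add: matrix_vector_mul_assoc matrix_inv_cancel)
  ultimately show ?thesis
    unfolding preserved_by_def by (metis imageE)
qed

lemma coordinate_subspace_not_preserved:
  fixes A B P :: mat3
  assumes P: "invertible P" and A: "A = conj_by P (diag l)"
    and irr: "\<And>V. vec.subspace V \<Longrightarrow> preserved_by A V \<Longrightarrow> preserved_by B V \<Longrightarrow> V = {0} \<or> V = UNIV"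
    and I: "I \<noteq> {}" "k \<notin> I"
  shows "\<exists>j\<in>I. \<exists>i. i \<notin> I \<and> conj_by (matrix_inv P) B $ i $ j \<noteq> 0"
proof (rule ccontr)
  define Q where "Q = matrix_inv P"
  assume "\<not> ?thesis"
  then have z: "conj_by Q B $ i $ j = 0" if "j \<in> I" "i \<notin> I" for i j
    using that by (auto simp: Q_def)
  \<comment> \<open>\<open>V\<close> is the image under \<open>P\<close> of the coordinate subspace
    of \<open>I\<close>. The diagonal form of \<open>A\<close> and the assumed zero block of
    \<open>B\<close> make it invariant under both.\<close>
  define V where "V = {v. \<forall>i. i \<notin> I \<longrightarrow> (Q *v v) $ i = 0}"
  have sub: "vec.subspace V"
    by (auto simp: V_def vec.subspace_def matrix_vector_right_distrib vector_scalar_commute)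
  have pres: "preserved_by X V" if X: "\<And>i j. j \<in> I \<Longrightarrow> i \<notin> I \<Longrightarrow> conj_by Q X $ i $ j = 0" for X
    unfolding preserved_by_def
  proof
    fix v assume v: "v \<in> V"
    have eq: "Q *v (X *v v) = conj_by Q X *v (Q *v v)"
      using P by (simp add: conj_by_def Q_def matrix_vector_mul_assoc matrix_group_simps flip: matrix_mul_assoc)
    have "(Q *v (X *v v)) $ i = 0" if "i \<notin> I" for i
      unfolding eq matrix_vector_mult_def[of "conj_by Q X"]
      using v X[OF _ that] by (fastforce simp: V_def intro: sum.neutral)
    then show "X *v v \<in> V" by (simp add: V_def)
  qed
  have "conj_by Q A = diag l"
    by (simp add: A Q_def conj_by_inv_cancel P)
  then have "preserved_by A V"
    using I by (intro pres) (auto simp: diag_def)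
  moreover have "preserved_by B V"
    by (intro pres z)
  ultimately have V: "V = {0} \<or> V = UNIV"
    by (rule irr[OF sub])
  have ax: "Q *v (P *v axis j 1) = axis j 1" for j
    using P by (simp add: Q_def matrix_vector_mul_assoc matrix_group_simps)
  obtain j where j: "j \<in> I" using I by blast
  \<comment> \<open>The images of a basis vector from \<open>I\<close> and of the basis vector
    \<open>k\<close> outside it show that \<open>V\<close> is neither zero nor everything.\<close>
  have "P *v axis j 1 \<in> V" using j by (simp add: V_def ax) (auto simp: axis_def)
  moreover have "P *v axis j 1 \<noteq> 0"
    using ax[of j] by (auto simp: axis_eq_0_iff)
  moreover have "P *v axis k 1 \<notin> V"
    using I by (simp add: V_def ax) (auto simp: axis_def)
  ultimately show False using V by blast
qed

lemma complex_cube_root: "z \<noteq> 0 \<Longrightarrow> \<exists>c::complex. c \<noteq> 0 \<and> c ^ 3 = z"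
  by (rule exI[of _ "exp (Ln z / 3)"]) (simp flip: exp_of_nat_mult)

text \<open>This is the determination of an irreducible pants representation by its eight trace
  quantities and the chosen root, in the loxodromic case. Both first members have the same ordered
  eigenvalues, so in eigenbases they become one diagonal matrix and the diagonal case
  applies.\<close>

lemma loxodromic_pair_conjugate:
  fixes A B A' B' :: mat3
  assumes lox: "strongly_loxodromic A" "strongly_loxodromic A'"
    and SL: "B \<in> carrier SL3" "B' \<in> carrier SL3"
    and irr: "\<And>V. vec.subspace V \<Longrightarrow> preserved_by A V \<Longrightarrow> preserved_by B V \<Longrightarrow> V = {0} \<or> V = UNIV"
    and trA: "trace A = trace A'" "trace (matrix_inv A) = trace (matrix_inv A')"
    and trB: "trace B = trace B'" "trace (matrix_inv B) = trace (matrix_inv B')"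
    and trBA: "trace (B ** A) = trace (B' ** A')" "trace (matrix_inv (B ** A)) = trace (matrix_inv (B' ** A'))"
    and sigma: "sigma_plus A B = sigma_plus A' B'" "sigma_minus A B = sigma_minus A' B'"
    and comm: "commutator_trace A B = commutator_trace A' B'"
  shows "\<exists>h\<in>carrier SL3. A' = conj_by h A \<and> B' = conj_by h B"
proof -
  obtain P l where P: "invertible P" and l: "decreasing_mod l" "\<And>i. l $ i \<noteq> 0" and A: "A = conj_by P (diag l)"
    using strongly_loxodromic_diagonalize[OF lox(1)] by metis
  obtain P' m where P': "invertible P'" and m: "decreasing_mod m" "\<And>i. m $ i \<noteq> 0"
    and A': "A' = conj_by P' (diag m)"
    using strongly_loxodromic_diagonalize[OF lox(2)] by metis
  have det: "det A = 1" "det A' = 1" "det B = 1" "det B' = 1"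
    using lox SL by (auto simp: strongly_loxodromic_def carrier_SL3)
  then have inv: "invertible A" "invertible A'" "invertible B" "invertible B'"
    by (simp_all add: invertible_det_nz)
  have "m = l"
    using loxodromic_same_eigenvalues[OF P l P' m] trA det by (simp add: A A')
  note A' = A'[unfolded this]
  define Q Q' where Q: "Q = matrix_inv P" "Q' = matrix_inv P'"
  have iQ: "invertible Q" "invertible Q'" by (simp_all add: Q P P' invertible_matrix_inv)
  have dA: "diag l = conj_by Q A" "diag l = conj_by Q' A'"
    by (simp_all add: Q A A' conj_by_inv_cancel P P')
  note cs = conj_by_mult[OF iQ(1)] conj_by_mult[OF iQ(2)] matrix_inv_conj_by[OF iQ(1)]
    matrix_inv_conj_by[OF iQ(2)] trace_conj_by[OF iQ(1)] trace_conj_by[OF iQ(2)]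
  have sig: "trace (matrix_inv A ** B) = trace (matrix_inv A' ** B')"
    "trace (A ** matrix_inv B) = trace (A' ** matrix_inv B')"
    using sigma trA trB trace_mul_sym[of A "matrix_inv B"] trace_mul_sym[of A' "matrix_inv B'"]
    by (simp_all add: sigma_plus_def sigma_minus_def)
  have tBA: "trace (A ** B) = trace (A' ** B')"
    "trace (matrix_inv A ** matrix_inv B) = trace (matrix_inv A' ** matrix_inv B')"
    using trBA by (simp_all add: trace_mul_sym[of B A] trace_mul_sym[of B' A'] inv matrix_group_simps)
  have "\<exists>e. (\<forall>i. e $ i \<noteq> 0) \<and> (\<forall>i j. e $ i * conj_by Q B $i$j = conj_by Q' B' $i$j * e $ j)"
  proof (rule diagonal_pair_conjugate[of l])
    show "trace (diag l ** conj_by Q B) = trace (diag l ** conj_by Q' B')"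
      by (subst dA(1), subst dA(2)) (simp add: cs tBA)
    show "trace (matrix_inv (diag l) ** conj_by Q B) = trace (matrix_inv (diag l) ** conj_by Q' B')"
      by (subst dA(1), subst dA(2)) (simp add: cs inv sig)
    show "trace (diag l ** matrix_inv (conj_by Q B)) = trace (diag l ** matrix_inv (conj_by Q' B'))"
      by (subst dA(1), subst dA(2)) (simp add: cs inv sig)
    show "trace (matrix_inv (diag l) ** matrix_inv (conj_by Q B))
        = trace (matrix_inv (diag l) ** matrix_inv (conj_by Q' B'))"
      by (subst dA(1), subst dA(2)) (simp add: cs inv tBA)
    show "commutator_trace (diag l) (conj_by Q B) = commutator_trace (diag l) (conj_by Q' B')"
      using comm by (subst dA(1), subst dA(2)) (simp add: commutator_trace_def cs inv)
    show "\<exists>j\<in>I. \<exists>i. i \<notin> I \<and> conj_by Q B $ i $ j \<noteq> 0" if "I \<noteq> {}" "k \<notin> I" for I k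
      unfolding Q by (rule coordinate_subspace_not_preserved[OF P A irr that])
  qed (use l decreasing_mod_distinct[OF l(1)] in \<open>simp_all add: cs inv trB det_conj_by iQ det\<close>)
  then obtain e where e: "\<And>i. e $ i \<noteq> 0" "\<And>i j. e $ i * conj_by Q B $i$j = conj_by Q' B' $i$j * e $ j"
    by blast
  \<comment> \<open>\<open>F\<close> already carries the pair to the other pair, but its determinant
    is arbitrary. A scalar \<open>c\<close> with \<open>c ^ 3\<close> inverse to
    \<open>det F\<close> moves it into SL(3,C) without changing the conjugation.\<close>
  define F where "F = P' ** diag e ** Q"
  have "invertible F"
    by (simp add: F_def P' iQ invertible_mult invertible_diag3 e)
  then have "det F \<noteq> 0" by (simp add: invertible_det_nz)
  then obtain c where c: "c \<noteq> 0" "c ^ 3 = inverse (det F)"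
    using complex_cube_root[of "inverse (det F)"] by auto
  define E :: mat3 where "E = diag (\<chi> i. c * e $ i)"
  define h where "h = P' ** E ** Q"
  have "det E = c ^ 3 * det (diag e)"
    by (simp add: E_def det_diag prod_UNIV_3 power3_eq_cube)
  then have "det h = c ^ 3 * det F"
    by (simp add: h_def F_def det_mul)
  then have h: "h \<in> carrier SL3"
    using c \<open>det F \<noteq> 0\<close> by (simp add: carrier_SL3)
  have EB: "E ** conj_by Q B = conj_by Q' B' ** E"
    using e(2) by (simp add: E_def vec_eq_iff diag_mult_nth mult.assoc mult.left_commute)
  have EA: "E ** conj_by Q A = conj_by Q' A' ** E"
    unfolding dA[symmetric] E_def by (simp add: vec_eq_iff diag_mult_nth diag_nth)
  have "X' = conj_by h X" if "E ** conj_by Q X = conj_by Q' X' ** E" for X X'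
  proof -
    have "P' ** (E ** conj_by Q X) ** Q = P' ** (conj_by Q' X' ** E) ** Q"
      by (simp add: that)
    then have "h ** X = X' ** h"
      by (simp add: h_def conj_by_def Q P P' matrix_group_simps flip: matrix_mul_assoc)
    then have "conj_by h X = X' ** (h ** matrix_inv h)"
      by (simp add: conj_by_def matrix_mul_assoc)
    then show ?thesis
      using h by (simp add: matrix_group_simps invertible_SL3)
  qed
  then show ?thesis using EA EB h by blast
qed

section \<open>Twist-bulge parameters of commuting matrices\<close>

lemma commutes_with_diag:
  fixes Z :: mat3
  assumes "decreasing_mod l" "Z ** diag l = diag l ** Z"
  shows "Z = diag (\<chi> i. Z $ i $ i)"
proof -
  have "\<forall>i j. i \<noteq> j \<longrightarrow> l $ i \<noteq> l $ j"
    using decreasing_mod_distinct[OF assms(1)] by (auto simp: forall_3)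
  moreover have "Z $ i $ j * l $ j = l $ i * Z $ i $ j" for i j
    using assms(2) by (metis diag_mult_nth)
  ultimately have "Z $ i $ j = 0" if "i \<noteq> j" for i j
    using that by (metis mult.commute mult_cancel_left)
  then show ?thesis by (auto simp: vec_eq_iff diag_nth)
qed

lemma conj_by_eq_iff:
  assumes "invertible P"
  shows "A = conj_by P X \<longleftrightarrow> A ** P = P ** X"
proof
  assume "A ** P = P ** X"
  then have "A ** P ** matrix_inv P = conj_by P X" by (simp add: conj_by_def)
  then show "A = conj_by P X" by (simp add: assms matrix_group_simps flip: matrix_mul_assoc)
qed (simp add: conj_by_def assms matrix_group_simps flip: matrix_mul_assoc)

lemma conj_by_self_iff:
  assumes "invertible P"
  shows "conj_by P X = X \<longleftrightarrow> P ** X = X ** P"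
  using conj_by_eq_iff[OF assms, of X X] by auto

lemma conj_by_diag_iff:
  fixes A :: mat3
  assumes "invertible P"
  shows "A = conj_by P (diag l) \<longleftrightarrow> (\<forall>i. has_eigenpair A (l $ i) (column i P))"
proof -
  have P: "P = col_matrix (\<lambda>j. column j P)"
    by (simp add: col_matrix_def column_def)
  have "column i P \<noteq> 0" for i
  proof
    assume "column i P = 0"
    moreover have "column i P = P *v axis i 1"
      by (simp add: vec_eq_iff column_def matrix_vector_mult_def axis_def if_distrib[where f="\<lambda>x. _ * x"] cong: if_cong)
    ultimately have "axis i (1::complex) = 0"
      using inj_matrix_vector_mult[OF assms] by (metis injD matrix_vector_mult_0_right)
    then show False by (simp add: axis_eq_0_iff)
  qed
  then show ?thesis
    unfolding has_eigenpair_def by (simp add: conj_by_eq_iff assms) (metis eigenvectors_iff P)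
qed

text \<open>The diagonal of T^u U^v in the ordered eigenbasis; its entries have product 1.\<close>

definition gluing_eigenvalues :: "complex \<Rightarrow> complex \<Rightarrow> complex^3" where
  "gluing_eigenvalues u v = vector [exp (u - v), exp (2 * v), exp (- u - v)]"

text \<open>The common eigenvectors become the columns of one matrix \<open>P\<close> diagonalising
  \<open>A\<close> and \<open>K\<close> at once, which makes the algebra of \<open>conj_by\<close>
  available.\<close>

lemma twist_bulge_iff:
  "twist_bulge A K u v \<longleftrightarrow>
     (\<exists>P l. invertible P \<and> decreasing_mod l \<and> A = conj_by P (diag l) \<and>
        K = conj_by P (diag (gluing_eigenvalues u v))) \<and>
     0 \<le> Im u \<and> Im u < 2 * pi \<and> 0 \<le> Im v \<and> Im v < pi" (is "?L \<longleftrightarrow> ?E \<and> ?R")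
proof
  assume L: ?L
  then obtain l1 l2 l3 x1 x2 x3 where
    e: "has_eigenpair A l1 x1" "has_eigenpair A l2 x2" "has_eigenpair A l3 x3"
      "cmod l1 > cmod l2" "cmod l2 > cmod l3"
    and K: "has_eigenpair K (exp (u - v)) x1" "has_eigenpair K (exp (2 * v)) x2"
      "has_eigenpair K (exp (- u - v)) x3"
    unfolding twist_bulge_def by blast
  define l :: "complex^3" where "l = vector [l1, l2, l3]"
  define x :: "3 \<Rightarrow> complex^3" where "x i = (if i = 1 then x1 else if i = 2 then x2 else x3)" for i
  have l: "decreasing_mod l" using e by (simp add: decreasing_mod_def l_def)
  have c: "column i (col_matrix x) = x i" for i
    by (simp add: column_def col_matrix_def)
  have A: "\<forall>i. has_eigenpair A (l $ i) (x i)"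
    using e by (simp add: forall_3 l_def x_def)
  then have P: "invertible (col_matrix x)"
    using l eigenvectors_conj_by by blast
  have "A = conj_by (col_matrix x) (diag l)"
    unfolding conj_by_diag_iff[OF P] c by (rule A)
  moreover have "K = conj_by (col_matrix x) (diag (gluing_eigenvalues u v))"
    unfolding conj_by_diag_iff[OF P] c using K by (simp add: forall_3 gluing_eigenvalues_def x_def)
  ultimately show "?E \<and> ?R"
    using P l L unfolding twist_bulge_def by blast
next
  assume R: "?E \<and> ?R"
  then obtain P l where "invertible P" "decreasing_mod l" "A = conj_by P (diag l)"
    "K = conj_by P (diag (gluing_eigenvalues u v))" by blast
  then have "decreasing_mod l" "\<forall>i. has_eigenpair A (l $ i) (column i P)"
    "\<forall>i. has_eigenpair K (gluing_eigenvalues u v $ i) (column i P)"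
    using conj_by_diag_iff by blast+
  then show ?L
    using R unfolding twist_bulge_def decreasing_mod_def forall_3 gluing_eigenvalues_def vector_3
    by blast
qed

text \<open>Eigenvectors of \<open>A\<close> are only unique up to scaling. Two ordered eigenbases
  differ by a \<open>Z\<close> that commutes with \<open>diag l\<close>, hence is diagonal and
  commutes with the diagonal form of \<open>K\<close>; so the choice of basis does not
  matter.\<close>

lemma twist_bulge_unique:
  assumes A: "strongly_loxodromic A" and K: "twist_bulge A K u v" "twist_bulge A K' u v"
  shows "K = K'"
proof -
  define D where "D = diag (gluing_eigenvalues u v)"
  obtain P l where P: "invertible P" "decreasing_mod l" "A = conj_by P (diag l)" "K = conj_by P D"
    using K(1) unfolding twist_bulge_iff D_def by blast
  obtain Q m where Q: "invertible Q" "decreasing_mod m" "A = conj_by Q (diag m)" "K' = conj_by Q D"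
    using K(2) unfolding twist_bulge_iff D_def by blast
  have "det A \<noteq> 0"
    using A by (simp add: strongly_loxodromic_def carrier_SL3)
  then have nz: "\<And>i. l $ i \<noteq> 0" "\<And>i. m $ i \<noteq> 0"
    using det_conj_by[OF P(1), of "diag l"] det_conj_by[OF Q(1), of "diag m"]
      invertible_diag3[of l] invertible_diag3[of m] unfolding invertible_det_nz
    by (simp_all flip: P(3) Q(3))
  have "m = l"
    using loxodromic_same_eigenvalues[OF Q(1,2) nz(2) P(1,2) nz(1)] by (simp flip: P(3) Q(3))
  define Z where "Z = matrix_inv P ** Q"
  have iZ: "invertible Z" and PZ: "Q = P ** Z"
    by (simp_all add: Z_def P(1) Q(1) matrix_group_simps)
  have "conj_by P (conj_by Z (diag l)) = conj_by P (diag l)"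
    using P(3) Q(3) by (simp add: conj_by_conj_by P(1) iZ \<open>m = l\<close> flip: PZ)
  then have "conj_by Z (diag l) = diag l"
    by (metis conj_by_inv_cancel(1) P(1))
  then have "Z = diag (\<chi> i. Z $ i $ i)"
    by (intro commutes_with_diag[OF P(2)]) (simp add: conj_by_self_iff iZ)
  moreover have "diag z ** diag w = diag w ** diag z" for z w :: "complex^3"
    by (simp add: vec_eq_iff diag_mult_nth) (simp add: diag_nth)
  ultimately have "conj_by Z D = D"
    unfolding conj_by_self_iff[OF iZ] D_def by metis
  then show "K = K'"
    by (simp add: P(4) Q(4) PZ P(1) iZ flip: conj_by_conj_by)
qed

lemma complex_log_Im_Arg2pi:
  assumes "w \<noteq> 0"
  shows "\<exists>z. exp z = w \<and> 0 \<le> Im z \<and> Im z < 2 * pi"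
proof (intro exI conjI)
  show "exp (of_real (ln (cmod w)) + \<i> * of_real (Arg2pi w)) = w"
    using assms Arg2pi_eq[of w] by (simp add: exp_add exp_of_real)
qed (simp_all add: Arg2pi_ge_0 Arg2pi_lt_2pi)

lemma twist_bulge_exists:
  assumes A: "strongly_loxodromic A" and K: "K \<in> carrier SL3" "K ** A = A ** K"
  shows "\<exists>u v. twist_bulge A K u v"
proof -
  obtain P l where P: "invertible P" "decreasing_mod l" "A = conj_by P (diag l)"
    using strongly_loxodromic_diagonalize[OF A] by metis
  define Q where "Q = matrix_inv P"
  have Q: "invertible Q" by (simp add: Q_def P(1) invertible_matrix_inv)
  have "conj_by Q K ** conj_by Q A = conj_by Q A ** conj_by Q K"
    using K(2) by (simp add: conj_by_mult Q)
  moreover have "conj_by Q A = diag l"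
    by (simp add: P(1,3) Q_def conj_by_inv_cancel)
  ultimately have KQ: "conj_by Q K = diag (\<chi> i. conj_by Q K $ i $ i)"
    by (intro commutes_with_diag[OF P(2)]) simp
  define \<kappa> where "\<kappa> = (\<chi> i. conj_by Q K $ i $ i)"
  have K\<kappa>: "K = conj_by P (diag \<kappa>)"
    unfolding \<kappa>_def KQ[symmetric] by (simp add: Q_def P(1) conj_by_inv_cancel)
  then have \<kappa>: "\<kappa>$1 * \<kappa>$2 * \<kappa>$3 = 1"
    using K(1) by (simp add: carrier_SL3 det_conj_by P(1) det_diag prod_UNIV_3)
  then have nz: "\<kappa>$1 \<noteq> 0" "\<kappa>$2 \<noteq> 0" "\<kappa>$3 \<noteq> 0" by auto
  \<comment> \<open>Halving a logarithm with imaginary part in [0, 2 pi) puts that of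
    \<open>v\<close> in [0, pi). Then \<open>u\<close> is a logarithm of
    \<open>\<kappa>$1 * exp v\<close>, and determinant 1 settles the third eigenvalue.\<close>
  obtain z where z: "exp z = \<kappa>$2" "0 \<le> Im z" "Im z < 2 * pi"
    using complex_log_Im_Arg2pi[OF nz(2)] by blast
  define v where "v = z / 2"
  obtain u where u: "exp u = \<kappa>$1 * exp v" "0 \<le> Im u" "Im u < 2 * pi"
    using complex_log_Im_Arg2pi[of "\<kappa>$1 * exp v"] nz by auto
  have "exp (u - v) = \<kappa>$1" by (simp add: exp_diff u)
  moreover have v2: "exp (2 * v) = \<kappa>$2" by (simp add: v_def z)
  moreover have "exp (- u - v) = \<kappa>$3"
  proof -
    have "exp v * exp v = \<kappa>$2" using v2 by (metis exp_add mult_2)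
    then have "\<kappa>$1 * exp v * exp v * \<kappa>$3 = 1" using \<kappa> by (simp add: mult.assoc)
    then show ?thesis using nz by (simp add: exp_diff exp_minus u field_simps)
  qed
  ultimately have "gluing_eigenvalues u v = \<kappa>"
    by (simp add: gluing_eigenvalues_def vec_eq_iff forall_3)
  moreover have "0 \<le> Im v" "Im v < pi" using z by (simp_all add: v_def)
  ultimately have "twist_bulge A K u v"
    unfolding twist_bulge_iff using P K\<kappa> u(2,3) by blast
  then show ?thesis by blast
qed

section \<open>Representations of the surface group\<close>

text \<open>Inversion keeps the eigenvectors and reverses the order of the moduli.\<close>

lemma strongly_loxodromic_inv:
  assumes "strongly_loxodromic A"
  shows "strongly_loxodromic (matrix_inv A)"
proof -
  have A: "A \<in> carrier SL3" "invertible A"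
    using assms invertible_SL3 by (auto simp: strongly_loxodromic_def)
  have pair: "has_eigenpair (matrix_inv A) (inverse l) x \<and> l \<noteq> 0" if "has_eigenpair A l x" for l x
  proof -
    have x: "x \<noteq> 0" "A *v x = l *s x" using that by (auto simp: has_eigenpair_def)
    have "x = matrix_inv A *v (A *v x)"
      by (simp add: matrix_vector_mul_assoc A matrix_group_simps)
    also have "\<dots> = l *s (matrix_inv A *v x)"
      by (simp add: x vector_scalar_commute)
    finally have e: "x = l *s (matrix_inv A *v x)" .
    then have "l \<noteq> 0" using x(1) by (metis vector_smult_lzero)
    moreover from this have "inverse l *s x = matrix_inv A *v x"
      by (subst e) (simp add: vector_smult_assoc)
    ultimately show ?thesis using x(1) by (simp add: has_eigenpair_def)
  qed
  obtain l1 l2 l3 x1 x2 x3 where e: "has_eigenpair A l1 x1" "has_eigenpair A l2 x2" "has_eigenpair A l3 x3"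
    "cmod l1 > cmod l2" "cmod l2 > cmod l3"
    using assms unfolding strongly_loxodromic_def by blast
  moreover have "cmod (inverse l3) > cmod (inverse l2)" "cmod (inverse l2) > cmod (inverse l1)"
    using e pair by (auto simp: norm_inverse)
  ultimately show ?thesis
    unfolding strongly_loxodromic_def using pair SL3_closed(3)[OF A(1)] by blast
qed

lemma strongly_loxodromic_conj_by:
  assumes "strongly_loxodromic A" "invertible P"
  shows "strongly_loxodromic (conj_by P A)"
proof -
  have "has_eigenpair (conj_by P A) l (P *v x)" if "has_eigenpair A l x" for l x
  proof -
    have "P *v x \<noteq> 0"
      using that inj_matrix_vector_mult[OF assms(2)] unfolding has_eigenpair_def
      by (metis injD matrix_vector_mult_0_right)
    moreover have "conj_by P A *v (P *v x) = P *v (A *v x)"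
      by (simp add: conj_by_def matrix_vector_mul_assoc assms(2) matrix_group_simps flip: matrix_mul_assoc)
    ultimately show ?thesis
      using that by (simp add: has_eigenpair_def vector_scalar_commute)
  qed
  moreover have "conj_by P A \<in> carrier SL3"
    using assms by (simp add: strongly_loxodromic_def carrier_SL3 det_conj_by)
  ultimately show ?thesis
    using assms(1) unfolding strongly_loxodromic_def by blast
qed

lemma preserved_by_mult: "preserved_by A V \<Longrightarrow> preserved_by B V \<Longrightarrow> preserved_by (A ** B) V"
  by (simp add: preserved_by_def flip: matrix_vector_mul_assoc)

section \<open>Homomorphisms into SL(3,C) and conjugation on generators\<close>

locale SL3_hom = group G for G (structure) +
  fixes \<rho> assumes hom: "\<rho> \<in> hom G SL3"
begin

lemma map_closed: "x \<in> carrier G \<Longrightarrow> \<rho> x \<in> carrier SL3"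
  using hom by (auto simp: hom_def)

lemma map_invertible: "x \<in> carrier G \<Longrightarrow> invertible (\<rho> x)"
  by (intro invertible_SL3 map_closed)

lemma map_mult: "x \<in> carrier G \<Longrightarrow> y \<in> carrier G \<Longrightarrow> \<rho> (x \<otimes> y) = \<rho> x ** \<rho> y"
  using hom by (auto simp: hom_def SL3_simps)

lemma map_one: "\<rho> \<one> = mat 1"
  using hom_one[OF hom] is_group group_SL3 by (simp add: SL3_simps)

lemma map_inv: "x \<in> carrier G \<Longrightarrow> \<rho> (inv x) = matrix_inv (\<rho> x)"
  using map_mult[of x "inv x"] by (intro matrix_inv_eqI[symmetric]) (simp add: map_one)

end

lemma conj_by_on_generate:
  assumes "SL3_hom G \<rho>" "SL3_hom G \<rho>'" and h: "invertible h"
    and S: "S \<subseteq> carrier G" and eq: "\<And>s. s \<in> S \<Longrightarrow> \<rho>' s = conj_by h (\<rho> s)"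
    and x: "x \<in> generate G S"
  shows "\<rho>' x = conj_by h (\<rho> x)"
proof -
  interpret r: SL3_hom G \<rho> by fact
  interpret r': SL3_hom G \<rho>' by fact
  show ?thesis
    using x
  proof (induction rule: generate.induct)
    case one
    then show ?case by (simp add: r.map_one r'.map_one conj_by_one h)
  next
    case (incl s)
    then show ?case by (rule eq)
  next
    case (inv s)
    then have "s \<in> carrier G" using S by blast
    then show ?case
      by (simp add: r.map_inv r'.map_inv eq inv matrix_inv_conj_by h r.map_invertible)
  next
    case (eng x y)
    then have "x \<in> carrier G" "y \<in> carrier G"
      using r.generate_in_carrier[OF S] by auto
    then show ?case by (simp add: r.map_mult r'.map_mult eng conj_by_mult h)
  qed
qed

section \<open>Generators and relations of the marked surface group\<close>

locale surface =
  fixes M :: "'a::topological_space marked_surface"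
  assumes genus: "genus M \<ge> 2" and marking: "surface_marking M"
begin

abbreviation "G \<equiv> surface_group M"
abbreviation "\<alpha> k \<equiv> elt M (Bd (k, Alpha))"
abbreviation "\<beta> k \<equiv> elt M (Bd (k, Beta))"
abbreviation "\<delta> k \<equiv> elt M (Bd (k, Delta))"
abbreviation "a j \<equiv> elt M (Bd (side M j))"
abbreviation "a' j \<equiv> elt M (Bd (side' M j))"
abbreviation "d j \<equiv> elt M (St j)"

lemma group_G: "group G"
  using marking group_fundamental_group by (auto simp: surface_marking_def)

sublocale group G by (rule group_G)

lemma bij_sides:
  "bij_betw (\<lambda>(j, s). if s then side M j else side' M j) ({..<ncurves M} \<times> UNIV) ({..<npants M} \<times> UNIV)"
  using marking by (simp add: surface_marking_def pants_decomposition_def)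

lemma side_pants:
  assumes "j < ncurves M"
  shows "fst (side M j) < npants M" "fst (side' M j) < npants M"
  using bij_betwE[OF bij_sides, rule_format, of "(j, True)"]
    bij_betwE[OF bij_sides, rule_format, of "(j, False)"] assms by auto

text \<open>Surjectivity of the pairing of sides: a claim about any boundary generator reduces to
  one about some \<open>a j\<close> or \<open>a' j\<close>.\<close>

lemma boundary_cases:
  assumes "k < npants M"
  obtains j where "j < ncurves M" "side M j = (k, b)" | j where "j < ncurves M" "side' M j = (k, b)"
proof -
  have "(k, b) \<in> (\<lambda>(j, s). if s then side M j else side' M j) ` ({..<ncurves M} \<times> UNIV)"
    using bij_betw_imp_surj_on[OF bij_sides] assms by simp
  then show thesis using that by (auto split: if_splits)
qed

lemma gens:
  shows Bd_gen: "k < npants M \<Longrightarrow> Bd (k, b) \<in> surface_gens M"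
    and St_gen: "j < ncurves M \<Longrightarrow> St j \<in> surface_gens M"
    and side_gen: "j < ncurves M \<Longrightarrow> Bd (side M j) \<in> surface_gens M"
    and side'_gen: "j < ncurves M \<Longrightarrow> Bd (side' M j) \<in> surface_gens M"
proof -
  show "k < npants M \<Longrightarrow> Bd (k, b) \<in> surface_gens M" for k b by (auto simp: surface_gens_def)
  note * = this
  show "j < ncurves M \<Longrightarrow> St j \<in> surface_gens M" by (auto simp: surface_gens_def)
  show "j < ncurves M \<Longrightarrow> Bd (side M j) \<in> surface_gens M"
    "j < ncurves M \<Longrightarrow> Bd (side' M j) \<in> surface_gens M"
    using side_pants *[of "fst (side M j)" "snd (side M j)"] *[of "fst (side' M j)" "snd (side' M j)"] by auto
qed

lemma presented: "presented_by G (surface_gens M) (surface_rels M) (elt M)"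
  using marking by (simp add: surface_marking_def)

lemma elt_closed: "x \<in> surface_gens M \<Longrightarrow> elt M x \<in> carrier G"
  using presented by (auto simp: presented_by_def)

lemmas closed = gens[THEN elt_closed]

lemma generated: "carrier G = generate G (elt M ` surface_gens M)"
  using presented by (simp add: presented_by_def)

lemma relator_eq_one:
  assumes "r \<in> surface_rels M" "r \<in> lists (surface_gens M \<times> UNIV)"
  shows "eval_word G (elt M) r = \<one>\<^bsub>G\<^esub>"
proof -
  \<comment> \<open>Empty contexts on both sides, so one step deletes the whole word.\<close>
  have "word_step (surface_rels M) ([] @ r @ []) ([] @ [])"
    using assms(1) by (rule word_step.relator)
  then have "equivclp (word_step (surface_rels M)) r []"
    by (auto intro: r_into_equivclp)
  then show ?thesis
    using presented assms(2) by (auto simp: presented_by_def)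
qed

lemma pants_relation:
  assumes "k < npants M"
  shows "\<delta> k \<otimes>\<^bsub>G\<^esub> (\<beta> k \<otimes>\<^bsub>G\<^esub> \<alpha> k) = \<one>\<^bsub>G\<^esub>"
  using relator_eq_one[of "[(Bd (k, Delta), True), (Bd (k, Beta), True), (Bd (k, Alpha), True)]"] assms closed
  by (auto simp: surface_rels_def Bd_gen)

lemma gluing_relation:
  assumes "j < ncurves M"
  shows "a' j \<otimes>\<^bsub>G\<^esub> (d j \<otimes>\<^bsub>G\<^esub> (a j \<otimes>\<^bsub>G\<^esub> inv\<^bsub>G\<^esub> d j)) = \<one>\<^bsub>G\<^esub>"
  using relator_eq_one[of "[(Bd (side' M j), True), (St j, True), (Bd (side M j), True), (St j, False)]"]
    assms closed
  by (auto simp: surface_rels_def gens)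

lemma tree_less: "j \<in> tree M \<Longrightarrow> j < ncurves M"
  using marking by (auto simp: surface_marking_def spanning_tree_def)

lemma tree_relation:
  assumes "j \<in> tree M"
  shows "d j = \<one>\<^bsub>G\<^esub>"
  using relator_eq_one[of "[(St j, True)]"] assms tree_less[OF assms] closed
  by (auto simp: surface_rels_def gens)

lemma pants_group_eq: "pants_group M k = generate G {\<alpha> k, \<beta> k, \<delta> k}"
proof -
  have UNIV_bdry: "(UNIV :: bdry set) = {Alpha, Beta, Delta}"
    using bdry.exhaust by blast
  show ?thesis unfolding pants_group_def UNIV_bdry by simp
qed

lemma Bd_in_pants_group: "elt M (Bd p) \<in> pants_group M (fst p)"
  unfolding pants_group_def by (cases p) (auto intro: generate.incl)

end

section \<open>Restriction of a representation to the pants groups\<close>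

locale surface_rep = surface +
  fixes \<rho> assumes rep: "\<rho> \<in> rep_space M"
begin

sublocale SL3_hom G \<rho>
  by unfold_locales (use rep in \<open>simp add: rep_space_def\<close>)

lemma rep_delta:
  assumes "k < npants M"
  shows "\<rho> (\<delta> k) = matrix_inv (\<rho> (\<beta> k) ** \<rho> (\<alpha> k))"
proof -
  have "\<rho> (\<delta> k) ** (\<rho> (\<beta> k) ** \<rho> (\<alpha> k)) = mat 1"
    using pants_relation[OF assms] assms by (simp add: closed map_one flip: map_mult)
  then show ?thesis
    by (intro matrix_inv_eqI[symmetric]) (simp add: matrix_left_right_inverse)
qed

lemma rep_a':
  assumes "j < ncurves M"
  shows "\<rho> (a' j) = conj_by (\<rho> (d j)) (matrix_inv (\<rho> (a j)))"
proof -
  note c = closed map_invertible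
  have "\<rho> (a' j) ** (\<rho> (d j) ** (\<rho> (a j) ** matrix_inv (\<rho> (d j)))) = mat 1"
    using gluing_relation[OF assms] assms by (simp add: c map_one flip: map_mult map_inv)
  then have "(\<rho> (d j) ** (\<rho> (a j) ** matrix_inv (\<rho> (d j)))) ** \<rho> (a' j) = mat 1"
    by (simp add: matrix_left_right_inverse)
  then have "\<rho> (a' j) = matrix_inv (\<rho> (d j) ** (\<rho> (a j) ** matrix_inv (\<rho> (d j))))"
    by (simp add: matrix_inv_eqI)
  then show ?thesis
    by (simp add: c assms conj_by_def matrix_group_simps flip: matrix_mul_assoc)
qed

lemma loxodromic_a: "j < ncurves M \<Longrightarrow> strongly_loxodromic (\<rho> (a j))"
  using rep by (simp add: rep_space_def)

text \<open>\<open>rep_space\<close> asks this of the elements \<open>a j\<close>; each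
  \<open>a' j\<close> is conjugate to the inverse of \<open>a j\<close>, and the two kinds exhaust
  the boundary generators.\<close>

lemma loxodromic_boundary:
  assumes "k < npants M"
  shows "strongly_loxodromic (\<rho> (elt M (Bd (k, b))))"
  using assms
proof (cases rule: boundary_cases[of k b])
  case (1 j)
  then show ?thesis using loxodromic_a[of j] by simp
next
  case (2 j)
  then show ?thesis
    using rep_a'[of j] loxodromic_a[of j] strongly_loxodromic_conj_by strongly_loxodromic_inv
    by (simp add: map_invertible closed)
qed

text \<open>Irreducibility passes from the pants group to the pair of its first two generators,
  because the third is the inverse of their product and invariance extends to inverses and
  products.\<close>

lemma irreducible_pants:
  assumes k: "k < npants M" and V: "vec.subspace V" "preserved_by (\<rho> (\<alpha> k)) V" "preserved_by (\<rho> (\<beta> k)) V"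
  shows "V = {0} \<or> V = UNIV"
proof -
  note c = closed
  have dl: "preserved_by (\<rho> (\<delta> k)) V"
    unfolding rep_delta[OF k] using V k
    by (intro preserved_by_inv preserved_by_mult) (simp_all add: invertible_mult map_invertible c)
  have S: "{\<alpha> k, \<beta> k, \<delta> k} \<subseteq> carrier G" using k c by auto
  have "preserved_by (\<rho> x) V" if "x \<in> generate G {\<alpha> k, \<beta> k, \<delta> k}" for x
    using that
  proof (induction rule: generate.induct)
    case one
    then show ?case by (simp add: map_one preserved_by_def)
  next
    case (incl h)
    then show ?case using V dl by blast
  next
    case (inv h)
    then have "preserved_by (\<rho> h) V" "h \<in> carrier G" using V dl S by auto
    then show ?case
      using V(1) by (simp add: map_inv preserved_by_inv map_invertible)
  next
    case (eng x y)
    then have "x \<in> carrier G" "y \<in> carrier G"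
      using generate_in_carrier[OF S] by auto
    then show ?case using eng by (simp add: map_mult preserved_by_mult)
  qed
  moreover have "irreducible_on (pants_group M k) \<rho>"
    using rep k by (simp add: rep_space_def)
  ultimately show ?thesis
    using V(1) unfolding irreducible_on_def pants_group_eq preserved_by_def by blast
qed

end

text \<open>Passing from \<open>a j\<close> to \<open>a' j\<close> inverts up to conjugation, so it
  merely exchanges the trace and the trace of the inverse.\<close>

lemma (in surface) same_traces_boundary:
  fixes b :: bdry
  assumes "\<rho> \<in> rep_space M" "\<rho>' \<in> rep_space M" "same_traces M \<rho> \<rho>'" and k: "k < npants M"
  defines "x \<equiv> elt M (Bd (k, b))"
  shows "trace (\<rho> x) = trace (\<rho>' x) \<and> trace (matrix_inv (\<rho> x)) = trace (matrix_inv (\<rho>' x))"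
proof -
  interpret r: surface_rep M \<rho> by unfold_locales fact
  interpret r': surface_rep M \<rho>' by unfold_locales fact
  have tr: "trace (\<rho> (a j)) = trace (\<rho>' (a j)) \<and>
      trace (matrix_inv (\<rho> (a j))) = trace (matrix_inv (\<rho>' (a j)))" if "j < ncurves M" for j
    using assms(3) that by (simp add: same_traces_def Let_def)
  show ?thesis
    using k
  proof (cases rule: boundary_cases[of k b])
    case (1 j)
    then show ?thesis using tr[of j] by (simp add: x_def)
  next
    case (2 j)
    then have x: "x = a' j" by (simp add: x_def)
    show ?thesis
      unfolding x using tr[OF 2(1)] 2(1)
      by (simp add: r.rep_a' r'.rep_a' closed r.map_invertible r'.map_invertible matrix_group_simps
          trace_conj_by matrix_inv_conj_by)
  qed
qed

section \<open>Frames, gluing matrices and the conjugating element\<close>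

lemma (in surface) pants_frames_exist:
  assumes "\<rho>\<^sub>0 \<in> rep_space M" "\<rho> \<in> rep_space M"
    and same: "same_traces M \<rho>\<^sub>0 \<rho>" "same_shapes M \<rho>\<^sub>0 \<rho>" "same_roots M \<rho>\<^sub>0 \<rho>"
  shows "\<exists>g. pants_frames M \<rho>\<^sub>0 \<rho> g"
proof -
  interpret r0: surface_rep M \<rho>\<^sub>0 by unfold_locales fact
  interpret r: surface_rep M \<rho> by unfold_locales fact
  have "\<exists>h\<in>carrier SL3. \<forall>x\<in>pants_group M k. \<rho> x = h ** \<rho>\<^sub>0 x ** matrix_inv h" if k: "k < npants M" for k
  proof -
    note tr = same_traces_boundary[OF assms(1,2) same(1) k]
    have inv: "invertible (\<rho>\<^sub>0 (\<alpha> k))" "invertible (\<rho>\<^sub>0 (\<beta> k))" "invertible (\<rho> (\<alpha> k))" "invertible (\<rho> (\<beta> k))"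
      by (simp_all add: r0.map_invertible r.map_invertible closed k)
    have "\<exists>h\<in>carrier SL3. \<rho> (\<alpha> k) = conj_by h (\<rho>\<^sub>0 (\<alpha> k)) \<and> \<rho> (\<beta> k) = conj_by h (\<rho>\<^sub>0 (\<beta> k))"
    proof (rule loxodromic_pair_conjugate)
      \<comment> \<open>\<open>\<delta> k\<close> maps to the inverse of the product, so its two
        traces are those of that product in exchanged order.\<close>
      show "trace (\<rho>\<^sub>0 (\<beta> k) ** \<rho>\<^sub>0 (\<alpha> k)) = trace (\<rho> (\<beta> k) ** \<rho> (\<alpha> k))"
        "trace (matrix_inv (\<rho>\<^sub>0 (\<beta> k) ** \<rho>\<^sub>0 (\<alpha> k))) = trace (matrix_inv (\<rho> (\<beta> k) ** \<rho> (\<alpha> k)))"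
        using tr[of Delta] unfolding r0.rep_delta[OF k] r.rep_delta[OF k]
        by (simp_all add: matrix_inv_matrix_inv inv invertible_mult)
      show "sigma_plus (\<rho>\<^sub>0 (\<alpha> k)) (\<rho>\<^sub>0 (\<beta> k)) = sigma_plus (\<rho> (\<alpha> k)) (\<rho> (\<beta> k))"
        "sigma_minus (\<rho>\<^sub>0 (\<alpha> k)) (\<rho>\<^sub>0 (\<beta> k)) = sigma_minus (\<rho> (\<alpha> k)) (\<rho> (\<beta> k))"
        using same(2) k by (simp_all add: same_shapes_def Let_def)
      show "commutator_trace (\<rho>\<^sub>0 (\<alpha> k)) (\<rho>\<^sub>0 (\<beta> k)) = commutator_trace (\<rho> (\<alpha> k)) (\<rho> (\<beta> k))"
        using same(3) k by (simp add: same_roots_def Let_def)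
    qed (use tr k in \<open>auto simp: r0.loxodromic_boundary r.loxodromic_boundary r0.map_closed r.map_closed closed
        dest: r0.irreducible_pants[OF k]\<close>)
    then obtain h where h: "h \<in> carrier SL3" "\<rho> (\<alpha> k) = conj_by h (\<rho>\<^sub>0 (\<alpha> k))" "\<rho> (\<beta> k) = conj_by h (\<rho>\<^sub>0 (\<beta> k))"
      by blast
    then have "\<rho> (\<delta> k) = conj_by h (\<rho>\<^sub>0 (\<delta> k))"
      using k inv by (simp add: r.rep_delta r0.rep_delta conj_by_mult matrix_inv_conj_by invertible_SL3 invertible_mult)
    then have "\<rho> x = conj_by h (\<rho>\<^sub>0 x)" if "x \<in> pants_group M k" for x
      using h k closed
      by (intro conj_by_on_generate[OF r0.SL3_hom_axioms r.SL3_hom_axioms _ _ _ that[unfolded pants_group_eq]]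
          invertible_SL3) auto
    then show ?thesis
      using h(1) unfolding conj_by_def by blast
  qed
  then obtain g where "\<forall>k<npants M. g k \<in> carrier SL3 \<and>
      (\<forall>x\<in>pants_group M k. \<rho> x = g k ** \<rho>\<^sub>0 x ** matrix_inv (g k))"
    by metis
  then show ?thesis unfolding pants_frames_def by blast
qed

lemma (in surface) gluing_matrix_exists:
  assumes "\<rho>\<^sub>0 \<in> rep_space M" "\<rho> \<in> rep_space M" and g: "pants_frames M \<rho>\<^sub>0 \<rho> g" and j: "j < ncurves M"
  shows "\<exists>K. gluing_matrix M \<rho>\<^sub>0 \<rho> g j K"
proof -
  interpret r0: surface_rep M \<rho>\<^sub>0 by unfold_locales fact
  interpret r: surface_rep M \<rho> by unfold_locales fact
  define k k' where k: "k = fst (side M j)" "k' = fst (side' M j)"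
  have gS: "g k \<in> carrier SL3" "g k' \<in> carrier SL3"
    using g side_pants[OF j] by (simp_all add: pants_frames_def k)
  then have ig: "invertible (g k)" "invertible (g k')" by (simp_all add: invertible_SL3)
  have fr: "\<rho> (a j) = conj_by (g k) (\<rho>\<^sub>0 (a j))" "\<rho> (a' j) = conj_by (g k') (\<rho>\<^sub>0 (a' j))"
    using g side_pants[OF j] Bd_in_pants_group by (simp_all add: pants_frames_def k conj_by_def)
  have inv: "invertible (\<rho>\<^sub>0 (a j))" "invertible (\<rho>\<^sub>0 (d j))" "invertible (\<rho> (d j))"
    using closed j by (simp_all add: r0.map_invertible r.map_invertible)
  \<comment> \<open>The solution for \<open>K\<close> of the gluing equation of an edge outside the
    tree.\<close>
  define L where "L = matrix_inv (\<rho>\<^sub>0 (d j)) ** (matrix_inv (g k') ** \<rho> (d j) ** g k)"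
  have L: "L \<in> carrier SL3"
    unfolding L_def using j by (intro SL3_closed gS r0.map_closed r.map_closed closed)
  then have iL: "invertible L" by (rule invertible_SL3)
  \<comment> \<open>\<open>L\<close> carries the inverse of \<open>\<rho>\<^sub>0 (a j)\<close> in
    turn to the inverse of \<open>\<rho> (a j)\<close>, to \<open>\<rho> (a' j)\<close>, to
    \<open>\<rho>\<^sub>0 (a' j)\<close> and back to the start, so it commutes with it.\<close>
  have "conj_by L (matrix_inv (\<rho>\<^sub>0 (a j))) =
      conj_by (matrix_inv (\<rho>\<^sub>0 (d j))) (conj_by (matrix_inv (g k'))
        (conj_by (\<rho> (d j)) (conj_by (g k) (matrix_inv (\<rho>\<^sub>0 (a j))))))"
    by (simp add: L_def conj_by_conj_by inv ig matrix_group_simps flip: matrix_mul_assoc)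
  also have "\<dots> = conj_by (matrix_inv (\<rho>\<^sub>0 (d j))) (conj_by (matrix_inv (g k')) (\<rho> (a' j)))"
    by (simp add: r.rep_a' j fr(1) matrix_inv_conj_by ig inv)
  also have "\<dots> = matrix_inv (\<rho>\<^sub>0 (a j))"
    by (simp add: fr(2) r0.rep_a' j conj_by_inv_cancel ig inv)
  finally have comm: "L ** \<rho>\<^sub>0 (a j) = \<rho>\<^sub>0 (a j) ** L"
    unfolding conj_by_self_iff[OF iL] by (rule matrix_commute_inv[OF inv(1)])
  show ?thesis
  proof (cases "j \<in> tree M")
    case True
    \<comment> \<open>On a tree edge the stable letter is trivial and the required gluing matrix is
      the inverse of \<open>L\<close>.\<close>
    have "L = matrix_inv (g k') ** g k"
      using True by (simp add: L_def tree_relation r0.map_one r.map_one matrix_inv_eqI)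
    then have "matrix_inv L = matrix_inv (g k) ** g k'"
      by (simp add: matrix_group_simps ig)
    moreover have "matrix_inv L ** \<rho>\<^sub>0 (a j) = \<rho>\<^sub>0 (a j) ** matrix_inv L"
    proof -
      have "\<rho>\<^sub>0 (a j) ** matrix_inv L = matrix_inv L ** (L ** \<rho>\<^sub>0 (a j)) ** matrix_inv L"
        by (simp add: matrix_group_simps iL)
      also have "\<dots> = matrix_inv L ** \<rho>\<^sub>0 (a j)"
        unfolding comm by (simp add: matrix_group_simps iL flip: matrix_mul_assoc)
      finally show ?thesis by simp
    qed
    ultimately show ?thesis
      using True SL3_closed(3)[OF L] unfolding gluing_matrix_def Let_def k by metis
  next
    case False
    have "matrix_inv (g k') ** \<rho> (d j) ** g k = \<rho>\<^sub>0 (d j) ** L"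
      by (simp add: L_def inv matrix_group_simps)
    then show ?thesis
      using False L comm unfolding gluing_matrix_def Let_def k by metis
  qed
qed

lemma (in surface) gluing_parameters_exist:
  assumes "\<rho>\<^sub>0 \<in> rep_space M" "\<rho> \<in> rep_space M"
    and "same_traces M \<rho>\<^sub>0 \<rho>" "same_shapes M \<rho>\<^sub>0 \<rho>" "same_roots M \<rho>\<^sub>0 \<rho>"
  shows "\<exists>u v. gluing_parameters M \<rho>\<^sub>0 \<rho> u v"
proof -
  interpret r0: surface_rep M \<rho>\<^sub>0 by unfold_locales fact
  obtain g where g: "pants_frames M \<rho>\<^sub>0 \<rho> g"
    using pants_frames_exist[OF assms] by blast
  have "\<exists>u v K. gluing_matrix M \<rho>\<^sub>0 \<rho> g j K \<and> twist_bulge (\<rho>\<^sub>0 (a j)) K u v" if j: "j < ncurves M" for j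
  proof -
    obtain K where K: "gluing_matrix M \<rho>\<^sub>0 \<rho> g j K"
      using gluing_matrix_exists[OF assms(1,2) g j] by blast
    then show ?thesis
      using twist_bulge_exists[OF r0.loxodromic_a[OF j], of K] by (auto simp: gluing_matrix_def Let_def)
  qed
  then obtain u v where "\<forall>j<ncurves M. \<exists>K. gluing_matrix M \<rho>\<^sub>0 \<rho> g j K \<and>
      twist_bulge (\<rho>\<^sub>0 (a j)) K (u j) (v j)"
    by metis
  then show ?thesis unfolding gluing_parameters_def using g by blast
qed

lemma (in surface) gluing_parameters_determine:
  assumes "\<rho>\<^sub>0 \<in> rep_space M" "\<rho> \<in> rep_space M" "\<rho>' \<in> rep_space M"
    and "gluing_parameters M \<rho>\<^sub>0 \<rho> u v" "gluing_parameters M \<rho>\<^sub>0 \<rho>' u v"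
  shows "conjugate_reps M \<rho> \<rho>'"
proof -
  interpret r0: surface_rep M \<rho>\<^sub>0 by unfold_locales fact
  interpret r: surface_rep M \<rho> by unfold_locales fact
  interpret r': surface_rep M \<rho>' by unfold_locales fact
  obtain g K where g: "pants_frames M \<rho>\<^sub>0 \<rho> g"
    and K: "\<And>j. j < ncurves M \<Longrightarrow> gluing_matrix M \<rho>\<^sub>0 \<rho> g j (K j) \<and> twist_bulge (\<rho>\<^sub>0 (a j)) (K j) (u j) (v j)"
    using assms(4) unfolding gluing_parameters_def by metis
  obtain g' K' where g': "pants_frames M \<rho>\<^sub>0 \<rho>' g'"
    and K': "\<And>j. j < ncurves M \<Longrightarrow> gluing_matrix M \<rho>\<^sub>0 \<rho>' g' j (K' j) \<and> twist_bulge (\<rho>\<^sub>0 (a j)) (K' j) (u j) (v j)"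
    using assms(5) unfolding gluing_parameters_def by metis
  have KK: "K' j = K j" if "j < ncurves M" for j
    using twist_bulge_unique[OF r0.loxodromic_a[OF that]] K K' that by blast
  \<comment> \<open>\<open>h k\<close> undoes the frame of \<open>\<rho>\<close> and applies that of
    \<open>\<rho>'\<close>, so it conjugates the first to the second on the k-th pants
    group.\<close>
  define h where "h k = g' k ** matrix_inv (g k)" for k
  have gS: "g k \<in> carrier SL3" "g' k \<in> carrier SL3" if "k < npants M" for k
    using g g' that by (simp_all add: pants_frames_def)
  note ig = gS[THEN invertible_SL3]
  have edge: "h (fst (side' M j)) = h (fst (side M j))" if j: "j \<in> tree M" for j
  proof -
    note jn = tree_less[OF j]
    note ig = ig[OF side_pants(1)[OF jn]] ig[OF side_pants(2)[OF jn]]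
    have eq: "matrix_inv (g (fst (side M j))) ** g (fst (side' M j)) = K j"
      "matrix_inv (g' (fst (side M j))) ** g' (fst (side' M j)) = K j"
      using K[OF jn] K'[OF jn] j by (simp_all add: gluing_matrix_def Let_def KK jn)
    have iK: "invertible (K j)"
      using K[OF jn] by (auto simp: gluing_matrix_def Let_def intro: invertible_SL3)
    \<comment> \<open>Both frames change by the same right factor \<open>K j\<close> across the
      edge, and this factor cancels in \<open>h\<close>.\<close>
    have "g (fst (side' M j)) = g (fst (side M j)) ** K j" "g' (fst (side' M j)) = g' (fst (side M j)) ** K j"
      by (simp_all add: ig matrix_group_simps flip: eq(1)) (simp add: eq(1), simp add: ig matrix_group_simps flip: eq(2))
    then show ?thesis
      by (simp add: h_def ig iK matrix_group_simps flip: matrix_mul_assoc)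
  qed
  \<comment> \<open>Genus at least 2 provides a pair of pants with index 0, used as the root from
    which equality of the \<open>h k\<close> spreads along the tree.\<close>
  have pos: "0 < npants M" using genus by (simp add: npants_def)
  define H where "H = h 0"
  have hH: "h k = H" if k: "k < npants M" for k
  proof -
    have "joined M (tree M) 0 k"
      using marking k pos by (auto simp: surface_marking_def spanning_tree_def)
    then show ?thesis
      unfolding joined_def H_def
    proof (induction rule: equivclp_induct)
      case (step y z)
      then show ?case using edge by auto
    qed simp
  qed
  have H: "H \<in> carrier SL3"
    unfolding H_def h_def using pos by (intro SL3_closed gS)
  have pants: "\<rho>' x = conj_by H (\<rho> x)" if k: "k < npants M" and x: "x \<in> pants_group M k" for k x
  proof -
    have "\<rho> x = conj_by (g k) (\<rho>\<^sub>0 x)" "\<rho>' x = conj_by (g' k) (\<rho>\<^sub>0 x)"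
      using g g' k x by (simp_all add: pants_frames_def conj_by_def)
    then show ?thesis
      using ig[OF k] by (simp add: h_def conj_by_conj_by matrix_group_simps flip: hH[OF k] matrix_mul_assoc)
  qed
  have stable: "\<rho>' (d j) = conj_by H (\<rho> (d j))" if j: "j < ncurves M" for j
  proof (cases "j \<in> tree M")
    case True
    then show ?thesis by (simp add: tree_relation r.map_one r'.map_one conj_by_one H invertible_SL3)
  next
    case False
    define k k' where k: "k = fst (side M j)" "k' = fst (side' M j)"
    have kn: "k < npants M" "k' < npants M" using side_pants[OF j] by (simp_all add: k)
    note ig = ig[OF kn(1)] ig[OF kn(2)]
    have "matrix_inv (g k') ** \<rho> (d j) ** g k = matrix_inv (g' k') ** \<rho>' (d j) ** g' k"
      using K[OF j] K'[OF j] False by (simp add: gluing_matrix_def Let_def KK j k)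
    \<comment> \<open>Both sides of the gluing equations equal
      \<open>\<rho>\<^sub>0 (d j) ** K j\<close>. Multiplying by the frames of
      \<open>\<rho>'\<close> leaves \<open>h k'\<close> and the inverse of \<open>h k\<close>, both
      coming from the same \<open>H\<close>.\<close>
    then have "g' k' ** (matrix_inv (g k') ** \<rho> (d j) ** g k) ** matrix_inv (g' k)
        = g' k' ** (matrix_inv (g' k') ** \<rho>' (d j) ** g' k) ** matrix_inv (g' k)"
      by simp
    then have "h k' ** \<rho> (d j) ** matrix_inv (h k) = \<rho>' (d j)"
      by (simp add: h_def ig matrix_group_simps flip: matrix_mul_assoc)
    then show ?thesis by (simp add: hH kn conj_by_def)
  qed
  have "\<rho>' s = conj_by H (\<rho> s)" if "s \<in> elt M ` surface_gens M" for s
    using that pants Bd_in_pants_group stable by (fastforce simp: surface_gens_def)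
  then have "\<rho>' x = conj_by H (\<rho> x)" if x: "x \<in> carrier G" for x
    using elt_closed
    by (intro conj_by_on_generate[OF r.SL3_hom_axioms r'.SL3_hom_axioms invertible_SL3[OF H] _ _
          x[unfolded generated]]) auto
  then show ?thesis
    unfolding conjugate_reps_def conj_by_def using H by blast
qed

text \<open>The frames are unique only up to cube roots of unity, so the parameters form a relation.
  The first conjunct says that this relation is never empty; the second is the determination up to
  conjugacy.\<close>

theorem theorem2p4:
  fixes M :: "'a::topological_space marked_surface"
    and ref :: "((real \<Rightarrow> 'a) set \<Rightarrow> complex^3^3) \<Rightarrow> ((real \<Rightarrow> 'a) set \<Rightarrow> complex^3^3)"
    and \<rho> \<rho>' :: "(real \<Rightarrow> 'a) set \<Rightarrow> complex^3^3"
  assumes "genus M \<ge> 2"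
    and "surface_marking M"
    and "reference_choice M ref"
    and "\<rho> \<in> rep_space M"
    and "\<rho>' \<in> rep_space M"
  shows "(\<exists>u v. gluing_parameters M (ref \<rho>) \<rho> u v) \<and>
    (same_traces M \<rho> \<rho>' \<and> same_shapes M \<rho> \<rho>' \<and> same_roots M \<rho> \<rho>' \<and> same_gluing M ref \<rho> \<rho>' \<longrightarrow>
       conjugate_reps M \<rho> \<rho>')"
proof -
  interpret surface M by unfold_locales (fact assms)+
  have ref: "ref \<rho> \<in> rep_space M" "same_traces M (ref \<rho>) \<rho>" "same_shapes M (ref \<rho>) \<rho>" "same_roots M (ref \<rho>) \<rho>"
    using assms(3,4) by (auto simp: reference_choice_def)
  have "conjugate_reps M \<rho> \<rho>'"
    if "same_traces M \<rho> \<rho>'" "same_shapes M \<rho> \<rho>'" "same_roots M \<rho> \<rho>'" "same_gluing M ref \<rho> \<rho>'"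
  proof -
    \<comment> \<open>The reference depends only on the data (1)-(3), so both sets of parameters are
      measured against the same representation.\<close>
    have "ref \<rho> = ref \<rho>'"
      using assms(3-5) that unfolding reference_choice_def by blast
    then show ?thesis
      using that(4) gluing_parameters_determine[OF ref(1) assms(4,5)] unfolding same_gluing_def by metis
  qed
  then show ?thesis
    using gluing_parameters_exist[OF ref(1) assms(4) ref(2-4)] by blast
qed

end
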